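(* Let $\{x_{\alpha}\}_{\alpha\in\mathbb{Z}}$ and $\{y_{\beta}\}_{\beta\in\mathbb{Z}}$ be two collections of real random variables on a common probability space, independent of each other, each of which is an admissible strongly multiplicative system (SMS) with uniformly bounded moments of all orders, i.e. $\sup_{\alpha\in\mathbb{Z}}\mathbb{E}|x_\alpha|^p<\infty$ and $\sup_{\beta\in\mathbb{Z}}\mathbb{E}|y_\beta|^p<\infty$ for every $p\ge 1$. For $n\ge 1$ let $M_n$ be the $n\times n$ random matrix with entries $$(M_n)_{ij}=x_{i-j}\,y_{i+j},\qquad 1\le i,j\le n.$$ Then $n^{-1/2}M_n$ converges in $*$-distribution to a circular variable in expected normalised trace; that is, if $c$ is a circular variable in a $*$-probability space $(\mathcal{A},\varphi)$, then for every $k\ge 1$ and all $\epsilon_1,\dots,\epsilon_k\in\{1,*\}$, $$\frac1n\,\mathbb{E}\,\mathrm{tr}\big((n^{-1/2}M_n)^{\epsilon_1}\cdots(n^{-1/2}M_n)^{\epsilon_k}\big)\xrightarrow{n\to\infty}\varphi(c^{\epsilon_1}\cdots c^{\epsilon_k}).$$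
   Context: SMS: a collection of random variables $\{x_\alpha\}_{\alpha\in I}$ is a strongly multiplicative system (SMS) if for all $n\ge1$, all distinct $\alpha_1,\dots,\alpha_n\in I$ and all $\eta_1,\dots,\eta_n\in\{1,2\}$, $\mathbb{E}\prod_{k=1}^n x_{\alpha_k}^{\eta_k}$ equals $1$ if $\eta_1=\cdots=\eta_n=2$ and equals $0$ otherwise. Admissible SMS: an SMS $\{x_\alpha\}_{\alpha\in I}$ in which every $x_\alpha$ has all moments finite is admissible if for all $n\ge1$, all distinct $\alpha_1,\dots,\alpha_n\in I$ and all integers $\eta_1,\dots,\eta_n\ge1$, one has $\mathbb{E}\prod_{k=1}^n x_{\alpha_k}^{\eta_k}=0$ whenever at least one $\eta_k$ equals $1$. A $*$-probability space $(\mathcal{A},\varphi)$ is a unital $*$-algebra $\mathcal{A}$ over $\mathbb{C}$ with a linear functional $\varphi$ satisfying $\varphi(1)=1$ and $\varphi(a^*a)\ge0$ for all $a$. A semi-circular variable is a self-adjoint $s\in\mathcal{A}$ with $\varphi(s^k)=C_{k/2}$ for $k$ even and $0$ for $k$ odd, where $C_m=\frac1{m+1}\binom{2m}{m}$. A circular variable is an element $c=(s_1+\mathrm{i}s_2)/\sqrt2$ with $s_1,s_2$ freely independent semi-circular variables. For a matrix or algebra element $a$, $a^1=a$ and $a^*$ is its adjoint (conjugate transpose for matrices). *)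

theory Defs
  imports "HOL-Probability.Probability" "Jordan_Normal_Form.Schur_Decomposition"
begin

section \<open>Strongly multiplicative systems\<close>

definition (in prob_space) SMS :: "'i set \<Rightarrow> ('i \<Rightarrow> 'a \<Rightarrow> real) \<Rightarrow> bool" where
  "SMS I x \<longleftrightarrow>
    (\<forall>\<alpha>\<in>I. random_variable borel (x \<alpha>)) \<and>
    (\<forall>n\<ge>1. \<forall>\<alpha> :: nat \<Rightarrow> 'i. \<forall>\<eta> :: nat \<Rightarrow> nat.
      inj_on \<alpha> {1..n} \<and> \<alpha> ` {1..n} \<subseteq> I \<and> \<eta> ` {1..n} \<subseteq> {1, 2} \<longrightarrow>
      expectation (\<lambda>\<omega>. \<Prod>k=1..n. x (\<alpha> k) \<omega> ^ \<eta> k) =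
        (if \<forall>k\<in>{1..n}. \<eta> k = 2 then 1 else 0))"

text \<open>
  No integrability of the products is demanded, because it follows: in an SMS the value 1 for
  products of distinct squares forces those to be integrable, and they dominate the other products
  through \<open>\<bar>t\<bar> \<le> 1 + t\<^sup>2\<close>; in an admissible SMS one uses the Hoelder inequality.
\<close>

definition (in prob_space) admissible_SMS :: "'i set \<Rightarrow> ('i \<Rightarrow> 'a \<Rightarrow> real) \<Rightarrow> bool" where
  "admissible_SMS I x \<longleftrightarrow>
    SMS I x \<and>
    (\<forall>\<alpha>\<in>I. \<forall>p :: nat. integrable M (\<lambda>\<omega>. x \<alpha> \<omega> ^ p)) \<and>
    (\<forall>n\<ge>1. \<forall>\<alpha> :: nat \<Rightarrow> 'i. \<forall>\<eta> :: nat \<Rightarrow> nat.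
      inj_on \<alpha> {1..n} \<and> \<alpha> ` {1..n} \<subseteq> I \<and> (\<forall>k\<in>{1..n}. \<eta> k \<ge> 1) \<and> (\<exists>k\<in>{1..n}. \<eta> k = 1) \<longrightarrow>
      expectation (\<lambda>\<omega>. \<Prod>k=1..n. x (\<alpha> k) \<omega> ^ \<eta> k) = 0)"

text \<open>Stated with the nonnegative integral, so that finiteness of each moment is part of it.\<close>

definition (in prob_space) uniformly_bounded_moments ::
    "'i set \<Rightarrow> ('i \<Rightarrow> 'a \<Rightarrow> real) \<Rightarrow> bool" where
  "uniformly_bounded_moments I x \<longleftrightarrow>
    (\<forall>p :: real. p \<ge> 1 \<longrightarrow> (SUP \<alpha>\<in>I. \<integral>\<^sup>+\<omega>. ennreal (\<bar>x \<alpha> \<omega>\<bar> powr p) \<partial>M) < \<infinity>)"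

definition (in prob_space) indep_families ::
    "'i set \<Rightarrow> ('i \<Rightarrow> 'a \<Rightarrow> real) \<Rightarrow> 'i set \<Rightarrow> ('i \<Rightarrow> 'a \<Rightarrow> real) \<Rightarrow> bool" where
  "indep_families I x J y \<longleftrightarrow>
    indep_var (PiM I (\<lambda>_. borel)) (\<lambda>\<omega>. \<lambda>\<alpha>\<in>I. x \<alpha> \<omega>)
              (PiM J (\<lambda>_. borel)) (\<lambda>\<omega>. \<lambda>\<beta>\<in>J. y \<beta> \<omega>)"


section \<open>Star-probability spaces and circular variables\<close>

locale star_algebra = vector_space scale
  for scale :: "complex \<Rightarrow> 'a::ring_1 \<Rightarrow> 'a" +
  fixes star :: "'a \<Rightarrow> 'a"
  assumes scale_mult_left: "scale z a * b = scale z (a * b)"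
    and scale_mult_right: "a * scale z b = scale z (a * b)"
    and star_add: "star (a + b) = star a + star b"
    and star_scale: "star (scale z a) = scale (cnj z) (star a)"
    and star_mult: "star (a * b) = star b * star a"
    and star_star: "star (star a) = a"
begin

definition star_subalgebra :: "'a set \<Rightarrow> bool" where
  "star_subalgebra B \<longleftrightarrow> subspace B \<and> 1 \<in> B \<and> (\<forall>a\<in>B. \<forall>b\<in>B. a * b \<in> B) \<and> (\<forall>a\<in>B. star a \<in> B)"

end

text \<open>
  Positivity refers to the order on the complex numbers from \<open>HOL-Library.Complex_Order\<close>:
  \<open>0 \<le> z\<close> says that \<open>z\<close> is real and nonnegative.
\<close>

locale star_prob_space = star_algebra scale star
  for scale :: "complex \<Rightarrow> 'a::ring_1 \<Rightarrow> 'a" and star :: "'a \<Rightarrow> 'a" +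
  fixes \<phi> :: "'a \<Rightarrow> complex"
  assumes linear_state: "Vector_Spaces.linear scale (*) \<phi>"
    and state_one: "\<phi> 1 = 1"
    and state_nonneg: "0 \<le> \<phi> (star a * a)"
begin

definition free_subalgebras :: "'i set \<Rightarrow> ('i \<Rightarrow> 'a set) \<Rightarrow> bool" where
  "free_subalgebras I B \<longleftrightarrow>
    (\<forall>is as. is \<noteq> [] \<and> length as = length is \<and> set is \<subseteq> I \<and> distinct_adj is \<and>
      (\<forall>j<length is. as ! j \<in> B (is ! j) \<and> \<phi> (as ! j) = 0) \<longrightarrow>
      \<phi> (prod_list as) = 0)"

definition freely_independent :: "'i set \<Rightarrow> ('i \<Rightarrow> 'a) \<Rightarrow> bool" where
  "freely_independent I a \<longleftrightarrow> free_subalgebras I (\<lambda>i. star_subalgebra hull {a i})"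

definition semicircular :: "'a \<Rightarrow> bool" where
  "semicircular s \<longleftrightarrow>
    star s = s \<and>
    (\<forall>k. \<phi> (s ^ k) =
      (if even k then (let m = k div 2 in of_nat (2 * m choose m) / of_nat (m + 1)) else 0))"

definition circular :: "'a \<Rightarrow> bool" where
  "circular c \<longleftrightarrow>
    (\<exists>s\<^sub>1 s\<^sub>2. semicircular s\<^sub>1 \<and> semicircular s\<^sub>2 \<and>
      freely_independent UNIV (\<lambda>b :: bool. if b then s\<^sub>1 else s\<^sub>2) \<and>
      c = scale (1 / complex_of_real (sqrt 2)) (s\<^sub>1 + scale \<i> s\<^sub>2))"

end


section \<open>Words in an element and its adjoint\<close>

datatype letter = One | Adj

primrec letter_apply :: "('b \<Rightarrow> 'b) \<Rightarrow> 'b \<Rightarrow> letter \<Rightarrow> 'b" where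
  "letter_apply adj a One = a"
| "letter_apply adj a Adj = adj a"

text \<open>Products of square matrices: the type of matrices of varying dimension is not a monoid.\<close>

definition mat_prod_list :: "nat \<Rightarrow> complex mat list \<Rightarrow> complex mat" where
  "mat_prod_list n As = foldr (*) As (1\<^sub>m n)"

definition mat_trace :: "complex mat \<Rightarrow> complex" where
  "mat_trace A = (\<Sum>i<dim_row A. A $$ (i, i))"

text \<open>
  Matrix indices start at 0 here, hence the shift by one. The entries are embedded into the complex
  numbers, so that the conjugate transpose is \<open>mat_adjoint\<close>.
\<close>

definition M_mat :: "(int \<Rightarrow> 'w \<Rightarrow> real) \<Rightarrow> (int \<Rightarrow> 'w \<Rightarrow> real) \<Rightarrow> nat \<Rightarrow> 'w \<Rightarrow> complex mat" where
  "M_mat x y n \<omega> = mat n n (\<lambda>(i, j).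
     complex_of_real (x (int (i + 1) - int (j + 1)) \<omega> * y (int (i + 1) + int (j + 1)) \<omega>))"

end

theory Submission
  imports Defs
begin

text \<open>
  Both sides count noncrossing pairings of the word that match each letter with an opposite one.

  For the circular element, the Chebyshev words of free semicircular variables have vanishing
  state, and a linear substitution carries this over to the words in \<open>c\<close> and \<open>c\<^sup>*\<close>. Expanding the
  word in this basis is a creation and annihilation process, whose vacuum coefficient is the count.

  The expected trace is a sum over closed walks in \<open>{0..<n}\<close>. By admissibility a walk contributes
  only if every difference and every sum of consecutive vertices, taken as an index of \<open>x\<close> or \<open>y\<close>,
  occurs at least twice. A walk is determined by its starting point and its differences, so there
  are \<open>O(n\<^bsup>1 + k/2\<^esup>)\<close> such walks. The top order arises only if the differences are paired and all
  linear relations are trivial, which makes the pairing noncrossing with opposite letters; both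
  expectations are then 1.
\<close>

text \<open>Noncrossing pairings never occur as objects: both sides are matched with the same stack
  recursion \<open>pairing_count\<close>. On the matrix side the main term is exact. Summed over all
  walks, \<open>runs\<close> gives \<open>n powr (1 + k/2)\<close> times the count for every
  positive \<open>n\<close>, so good walks are never counted asymptotically. The whole error sits on
  the bad walks, for which an upper bound suffices: they have at most \<open>(k - 1) div 2\<close>
  free differences besides the starting point, the moments bound each contribution, and the
  normalisation leaves a factor of order \<open>n powr - (1/2)\<close>. The obstacle is that
  repeated differences alone allow crossing pairings, as for Toeplitz matrices. The sums exclude
  them: equality of two sums is a linear relation among the differences, and a crossing pairing can
  satisfy it only by giving up a free difference.\<close>

section \<open>Moments of a circular element\<close>

text \<open>
  Scans a word with a stack \<open>v\<close>: every letter is either pushed or cancels the top of the stack when \<open>r\<close>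
  allows it. With empty \<open>v\<close> this counts the noncrossing pairings of the word by pairs related by \<open>r\<close>.
\<close>

fun pairing_count :: "('b \<Rightarrow> 'b \<Rightarrow> bool) \<Rightarrow> 'b list \<Rightarrow> 'b list \<Rightarrow> nat" where
  "pairing_count r [] v = (if v = [] then 1 else 0)"
| "pairing_count r (p # w) v = pairing_count r w (p # v) +
     (case v of [] \<Rightarrow> 0 | q # v' \<Rightarrow> if r p q then pairing_count r w v' else 0)"

text \<open>
  Multivariate Chebyshev polynomials of the second kind. Words are read from right to left, so that
  right multiplication by \<open>a p\<close> acts on them as creation plus annihilation on a full Fock space.
\<close>

fun cheb :: "('b \<Rightarrow> 'b \<Rightarrow> bool) \<Rightarrow> ('b \<Rightarrow> 'a::ring_1) \<Rightarrow> 'b list \<Rightarrow> 'a" where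
  "cheb r a [] = 1"
| "cheb r a (p # v) = cheb r a v * a p -
     (case v of [] \<Rightarrow> 0 | q # v' \<Rightarrow> if r p q then cheb r a v' else 0)"

lemma cheb_Cons_Cons:
  "cheb r a (p # q # v) = cheb r a (q # v) * a p - (if r p q then cheb r a v else 0)"
  by simp

text \<open>Nonnegative lattice paths of \<open>k\<close> unit steps between heights 0 and
  \<open>j\<close>. They are the coefficients of \<open>s ^ k\<close> in the Chebyshev polynomials,
  as multiplication by \<open>s\<close> moves the degree to its two neighbours.\<close>

fun ballot :: "nat \<Rightarrow> nat \<Rightarrow> nat" where
  "ballot 0 j = (if j = 0 then 1 else 0)"
| "ballot (Suc k) j = ballot k (Suc j) + (case j of 0 \<Rightarrow> 0 | Suc j' \<Rightarrow> ballot k j')"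

lemma ballot_eq_0: "k < j \<Longrightarrow> ballot k j = 0"
  by (induction k arbitrary: j) (auto split: nat.splits)

lemma ballot_diag: "ballot k k = 1"
  by (induction k) (auto simp: ballot_eq_0)

lemma ballot_odd: "odd (k + j) \<Longrightarrow> ballot k j = 0"
  by (induction k arbitrary: j) (auto split: nat.splits intro: odd_pos)

text \<open>The reflection principle: for \<open>k = 2 * l + j\<close>, all paths with
  \<open>l\<close> minority steps minus those that touch height -1. Over the integers Pascal's rule
  holds for these differences without restriction on \<open>l\<close>.\<close>

definition binomial_step :: "nat \<Rightarrow> nat \<Rightarrow> int" where
  "binomial_step k l = int (k choose l) - (case l of 0 \<Rightarrow> 0 | Suc l' \<Rightarrow> int (k choose l'))"

lemma binomial_step_Suc:
  "binomial_step (Suc k) (Suc l) = binomial_step k (Suc l) + binomial_step k l"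
  by (auto simp: binomial_step_def split: nat.splits)

lemma ballot_even: "k = 2 * l + j \<Longrightarrow> int (ballot k j) = binomial_step k l"
proof (induction k arbitrary: j l)
  case 0
  then show ?case by (simp add: binomial_step_def)
next
  case (Suc k)
  show ?case
  proof (cases l)
    case 0
    then have "j = Suc k" using Suc.prems by simp
    then show ?thesis using 0 by (simp add: ballot_eq_0 ballot_diag binomial_step_def)
  next
    case l: (Suc l')
    have up: "int (ballot k (Suc j)) = binomial_step k l'"
      using Suc.prems l by (intro Suc.IH) simp
    show ?thesis
    proof (cases j)
      case 0
      \<comment> \<open>Here \<open>k = 2 * l' + 1\<close>, whose two middle binomial coefficients
        agree. So the Pascal term for height -1, which the ballot recursion lacks, is zero.\<close>
      then have "k - Suc l' = l'" "Suc l' \<le> k" using Suc.prems l by auto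
      then have "k choose Suc l' = k choose l'"
        using binomial_symmetric[of "Suc l'" k] by simp
      then have "binomial_step k (Suc l') = 0" by (simp add: binomial_step_def)
      then show ?thesis using up l 0 by (simp add: binomial_step_Suc)
    next
      case (Suc j')
      have "int (ballot k j') = binomial_step k (Suc l')"
        using Suc.prems l Suc by (intro Suc.IH) simp
      then show ?thesis using up l Suc by (simp add: binomial_step_Suc)
    qed
  qed
qed

lemma ballot_catalan:
  "(of_nat (ballot (2 * m) 0) :: complex) = of_nat (2 * m choose m) / of_nat (m + 1)"
proof -
  have "int (Suc m) * binomial_step (2 * m) m = int (2 * m choose m)"
  proof (cases m)
    case (Suc l)
    have "Suc l * (Suc (Suc (2 * l)) choose Suc l) = Suc (Suc (2*l)) * (Suc (2 * l) choose l)"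
      by (rule Suc_times_binomial)
    moreover have "(Suc (2 * l) choose Suc l) = (Suc (2 * l) choose l)"
      using binomial_symmetric[of "Suc l" "Suc (2*l)"] by simp
    moreover have "Suc (Suc l) * (Suc (Suc (2 * l)) choose l) = Suc l * (Suc (Suc (2*l)) choose Suc l)"
      using Suc_times_binomial_add[of l "Suc l"] by (simp add: mult_2)
    ultimately have "int (Suc (Suc l)) * int (Suc (Suc (2 * l)) choose l) = 
        int (Suc l) * int (Suc (Suc (2*l)) choose Suc l)"
      by (metis of_nat_mult)
    then show ?thesis using Suc by (simp add: binomial_step_def algebra_simps)
  qed (simp add: binomial_step_def)
  then have "int (Suc m * ballot (2 * m) 0) = int (2 * m choose m)"
    using ballot_even[of "2 * m" m 0] by (simp only: of_nat_mult)
  then have "Suc m * ballot (2 * m) 0 = 2 * m choose m" by linarith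
  then have "of_nat (Suc m) * (of_nat (ballot (2 * m) 0) :: complex) = of_nat (2 * m choose m)"
    by (metis of_nat_mult)
  then show ?thesis
    by (metis Suc_eq_plus1 nonzero_mult_div_cancel_left of_nat_neq_0)
qed

text \<open>Multilinear substitution: the letter \<open>p\<close> becomes the vector with
  coordinates \<open>K p True\<close> and \<open>K p False\<close>, and \<open>g\<close> is extended
  from basis words. Keeping \<open>g\<close> an arbitrary function lets it be \<open>cheb\<close>,
  which is not multiplicative in the word.\<close>

fun expand :: "(complex \<Rightarrow> 'a::ring_1 \<Rightarrow> 'a) \<Rightarrow> ('b \<Rightarrow> bool \<Rightarrow> complex) \<Rightarrow> 'b list \<Rightarrow> (bool list \<Rightarrow> 'a) \<Rightarrow> 'a" where
  "expand scl K [] g = g []"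
| "expand scl K (p # v) g = scl (K p True) (expand scl K v (\<lambda>t. g (True # t))) +
     scl (K p False) (expand scl K v (\<lambda>t. g (False # t)))"

text \<open>The correction term of the recursion arises only between equal neighbours, so the
  product splits at a block boundary. The factors appear in reverse because words are read from
  right to left.\<close>

lemma cheb_replicate_append:
  assumes "v = [] \<or> hd v \<noteq> b"
  shows "cheb (=) a (replicate m b @ v) = cheb (=) a v * cheb (=) a (replicate m b)"
proof (induction m rule: less_induct)
  case (less m)
  consider "m = 0" | "m = 1" | l where "m = Suc (Suc l)"
    by (metis One_nat_def not0_implies_Suc)
  then show ?case
  proof cases
    case 2
    then show ?thesis using assms by (cases v) auto
  next
    case 3
    have "cheb (=) a (replicate m b @ v) = cheb (=) a (replicate (Suc l) b @ v) * a b -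
        cheb (=) a (replicate l b @ v)"
      unfolding 3 replicate_Suc append_Cons cheb_Cons_Cons by simp
    also have "\<dots> = cheb (=) a v * (cheb (=) a (replicate (Suc l) b) * a b - cheb (=) a (replicate l b))"
      using less[of l] less[of "Suc l"] 3
      by (simp only: lessI less_SucI mult.assoc right_diff_distrib)
    also have "\<dots> = cheb (=) a v * cheb (=) a (replicate m b)"
      unfolding 3 replicate_Suc append_Cons cheb_Cons_Cons by simp
    finally show ?thesis .
  qed simp
qed

lemma power_eq_cheb:
  fixes s :: "'a::ring_1"
  shows "s ^ k = (\<Sum>j\<le>k. of_nat (ballot k j) * cheb (=) (\<lambda>_. s) (replicate j b))"
proof (induction k)
  case 0
  then show ?case by simp
next
  case (Suc k)
  let ?U = "\<lambda>j. cheb (=) (\<lambda>_. s) (replicate j b)"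
  have U: "?U j * s = ?U (Suc j) + (case j of 0 \<Rightarrow> 0 | Suc j' \<Rightarrow> ?U j')" for j
    by (cases j) simp_all
  have "s ^ Suc k = (\<Sum>j\<le>k. of_nat (ballot k j) * (?U (Suc j) + (case j of 0 \<Rightarrow> 0 | Suc j' \<Rightarrow> ?U j')))"
    by (simp only: power_Suc2 Suc sum_distrib_right mult.assoc U)
  also have "\<dots> = (\<Sum>j\<le>k. of_nat (ballot k j) * ?U (Suc j)) +
      (\<Sum>j\<le>k. of_nat (ballot k j) * (case j of 0 \<Rightarrow> 0 | Suc j' \<Rightarrow> ?U j'))"
    by (simp only: distrib_left sum.distrib)
  also have "(\<Sum>j\<le>k. of_nat (ballot k j) * ?U (Suc j)) =
      (\<Sum>j\<le>Suc k. (case j of 0 \<Rightarrow> 0 | Suc j' \<Rightarrow> of_nat (ballot k j')) * ?U j)"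
    by (simp only: sum.atMost_Suc_shift) simp
  also have "(\<Sum>j\<le>k. of_nat (ballot k j) * (case j of 0 \<Rightarrow> 0 | Suc j' \<Rightarrow> ?U j')) =
      (\<Sum>j\<le>Suc (Suc k). of_nat (ballot k j) * (case j of 0 \<Rightarrow> 0 | Suc j' \<Rightarrow> ?U j'))"
    by (intro sum.mono_neutral_left) (auto simp: ballot_eq_0)
  also have "\<dots> = (\<Sum>j\<le>Suc k. of_nat (ballot k (Suc j)) * ?U j)"
    by (simp only: sum.atMost_Suc_shift[of _ "Suc k"]) simp
  also have "(\<Sum>j\<le>Suc k. (case j of 0 \<Rightarrow> 0 | Suc j' \<Rightarrow> of_nat (ballot k j')) * ?U j) + \<dots> =
      (\<Sum>j\<le>Suc k. of_nat (ballot (Suc k) j) * ?U j)"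
    unfolding sum.distrib[symmetric]
    by (intro sum.cong refl) (auto simp: algebra_simps split: nat.splits)
  finally show ?case .
qed

lemma cheb_map_eq: "cheb (=) a (replicate m b) = cheb (=) (\<lambda>_. a b) (replicate m b)"
  by (induction m rule: induct_nat_012) auto

context star_algebra
begin

lemma expand_diff:
  "expand scale K v (\<lambda>t. g t - h t) = expand scale K v g - expand scale K v h"
  by (induction v arbitrary: g h) (simp_all add: scale_right_diff_distrib)

lemma expand_mult:
  "expand scale K v (\<lambda>t. g t * a) = expand scale K v g * a"
  by (induction v arbitrary: g) (simp_all add: distrib_right scale_mult_left)

lemma expand_zero: "expand scale K v (\<lambda>t. 0) = 0"
  by (induction v) simp_all

text \<open>
  The hypothesis on \<open>K\<close> says that the linear substitution preserves the covariance. For a circular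
  element it turns the orthonormal pair \<open>s\<^sub>1, s\<^sub>2\<close> into \<open>c, c\<^sup>*\<close> with covariance \<open>\<noteq>\<close>.
\<close>

lemma cheb_expand:
  assumes u: "\<And>p. u p = scale (K p True) (s True) + scale (K p False) (s False)"
    and K: "\<And>p q. K p True * K q True + K p False * K q False = (if r p q then 1 else 0)"
  shows "cheb r u v = expand scale K v (cheb (=) s)"
proof (induction v rule: induct_list012)
  case 1
  show ?case by simp
next
  case (2 p)
  show ?case by (simp add: u)
next
  case (3 p q v)
  let ?E = "expand scale K v" and ?W = "cheb (=) s"
  have E: "?E (\<lambda>t. ?W (b # b' # t)) =
      ?E (\<lambda>t. ?W (b' # t)) * s b - (if b = b' then ?E ?W else 0)" for b b'
    unfolding cheb_Cons_Cons expand_diff expand_mult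
    by (cases "b = b'") (simp_all only: if_True if_False expand_zero simp_thms)
  have "cheb r u (p # q # v) = cheb r u (q # v) * u p - (if r p q then cheb r u v else 0)"
    by simp
  also have "\<dots> = (scale (K q True) (?E (\<lambda>t. ?W (True # t))) +
      scale (K q False) (?E (\<lambda>t. ?W (False # t)))) * u p - scale (if r p q then 1 else 0) (?E ?W)"
    using 3 by simp
  also have "\<dots> = expand scale K (p # q # v) ?W"
    unfolding K[of p q, symmetric] u expand.simps E
    by (simp add: algebra_simps scale_mult_left scale_mult_right scale_left_distrib
        scale_right_distrib scale_right_diff_distrib)
  finally show ?case .
qed

end

section \<open>The state on Chebyshev words\<close>

context star_prob_space
begin

lemma state_add: "\<phi> (a + b) = \<phi> a + \<phi> b"
  and state_scale: "\<phi> (scale z a) = z * \<phi> a"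
  and state_zero: "\<phi> 0 = 0"
proof -
  interpret L: Vector_Spaces.linear scale "(*)" \<phi> by (rule linear_state)
  show "\<phi> (a + b) = \<phi> a + \<phi> b" "\<phi> (scale z a) = z * \<phi> a" "\<phi> 0 = 0"
    by (simp_all add: L.add L.scale L.zero)
qed

lemma state_expand_eq_0:
  assumes "\<And>t. length t = length v \<Longrightarrow> \<phi> (g t) = 0"
  shows "\<phi> (expand scale K v g) = 0"
  using assms by (induction v arbitrary: g) (simp_all add: state_add state_scale)

text \<open>Solved for \<open>cheb r a v * a p\<close>, the Chebyshev recursion is the recursion of
  \<open>pairing_count\<close> with stack \<open>v\<close>. Once all letters are absorbed, only the
  empty stack has a nonzero state.\<close>

lemma state_prod_list:
  assumes "\<And>v. v \<noteq> [] \<Longrightarrow> \<phi> (cheb r a v) = 0"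
  shows "\<phi> (cheb r a v * prod_list (map a w)) = of_nat (pairing_count r w v)"
proof (induction w arbitrary: v)
  case Nil
  then show ?case using assms by (auto simp: state_one)
next
  case (Cons p w)
  have "cheb r a v * a p = cheb r a (p # v) +
      (case v of [] \<Rightarrow> 0 | q # v' \<Rightarrow> if r p q then cheb r a v' else 0)"
    by simp
  then have "cheb r a v * prod_list (map a (p # w)) = cheb r a (p # v) * prod_list (map a w) +
      (case v of [] \<Rightarrow> 0 | q # v' \<Rightarrow> if r p q then cheb r a v' else 0) * prod_list (map a w)"
    by (simp only: list.map prod_list.Cons mult.assoc[symmetric] distrib_right)
  then show ?case
    by (simp only: state_add Cons.IH pairing_count.simps)
      (auto split: list.splits simp: Cons.IH state_zero)
qed

lemma state_of_nat_mult: "\<phi> (of_nat m * a) = of_nat m * \<phi> a"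
  by (induction m) (simp_all add: state_zero state_add algebra_simps)

lemma state_sum: "\<phi> (sum f A) = (\<Sum>j\<in>A. \<phi> (f j))"
  by (induction A rule: infinite_finite_induct) (simp_all add: state_zero state_add)

text \<open>In the expansion of \<open>s ^ m\<close> the constant term \<open>ballot m 0\<close> is
  already the full moment. By induction the degrees strictly between 0 and \<open>m\<close> vanish
  under the state, and degree \<open>m\<close> has coefficient 1.\<close>

lemma semicircular_cheb:
  assumes "semicircular s" "m \<ge> 1"
  shows "\<phi> (cheb (=) (\<lambda>_. s) (replicate m b)) = 0"
  using assms(2)
proof (induction m rule: less_induct)
  case (less m)
  let ?U = "\<lambda>j. cheb (=) (\<lambda>_. s) (replicate j b)"
  have "\<phi> (s ^ m) = of_nat (ballot m 0)"
    using assms(1) ballot_odd[of m 0] ballot_catalan[of "m div 2"]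
    unfolding semicircular_def by (auto simp: Let_def)
  moreover have "\<phi> (s ^ m) = (\<Sum>j\<le>m. of_nat (ballot m j) * \<phi> (?U j))"
    by (subst power_eq_cheb[of _ _ b]) (simp add: state_sum state_of_nat_mult)
  moreover have "\<dots> = (\<Sum>j\<in>{0, m}. of_nat (ballot m j) * \<phi> (?U j))"
    using less by (intro sum.mono_neutral_right) auto
  moreover have "\<dots> = of_nat (ballot m 0) + \<phi> (?U m)"
    using less.prems by (simp add: ballot_diag state_one)
  ultimately show ?case by simp
qed

lemma cheb_replicate_mem_hull:
  "cheb (=) (\<lambda>_. s) (replicate m b) \<in> star_subalgebra hull {s}"
proof -
  have "cheb (=) (\<lambda>_. s) (replicate m b) \<in> B" if B: "star_subalgebra B" "s \<in> B" for B
  proof (induction m rule: less_induct)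
    case (less m)
    consider "m = 0" | "m = 1" | l where "m = Suc (Suc l)"
      by (metis One_nat_def not0_implies_Suc)
    then show ?case
    proof cases
      case 3
      then show ?thesis using less[of l] less[of "Suc l"] B
        by (auto simp: star_subalgebra_def intro!: subspace_diff)
    qed (use B in \<open>auto simp: star_subalgebra_def\<close>)
  qed
  then show ?thesis by (auto simp: hull_def)
qed

text \<open>Cut the word into maximal blocks of equal letters: each block is a centred polynomial in
  one variable. The clause on \<open>last is\<close> keeps neighbours distinct when the leading
  block, which becomes the last factor, is appended.\<close>

lemma cheb_eq_alternating_product:
  assumes "\<And>b. semicircular (s b)" "v \<noteq> []"
  shows "\<exists>is as. is \<noteq> [] \<and> length as = length is \<and> distinct_adj is \<and> last is = hd v \<and>
      (\<forall>j<length is. as ! j \<in> star_subalgebra hull {s (is ! j)} \<and> \<phi> (as ! j) = 0) \<and>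
      prod_list as = cheb (=) s v"
  using assms(2)
proof (induction "length v" arbitrary: v rule: less_induct)
  case less
  define b where "b = hd v"
  define v1 where "v1 = takeWhile (\<lambda>x. x = b) v"
  define v2 where "v2 = dropWhile (\<lambda>x. x = b) v"
  define m where "m = length v1"
  have v1: "v1 = replicate m b"
    unfolding m_def v1_def by (metis (mono_tags, lifting) replicate_length_same set_takeWhileD)
  have v: "v = replicate m b @ v2" unfolding v1[symmetric] by (simp add: v1_def v2_def)
  have m: "m \<ge> 1" using less.prems unfolding m_def v1_def b_def by (cases v) auto
  have v2: "v2 = [] \<or> hd v2 \<noteq> b" using hd_dropWhile[of "\<lambda>x. x = b" v] by (auto simp: v2_def)
  let ?U = "cheb (=) s (replicate m b)"
  have U: "?U \<in> star_subalgebra hull {s b}" "\<phi> ?U = 0"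
    using cheb_replicate_mem_hull[of "s b" m b] semicircular_cheb[OF assms(1)[of b] m, of b]
    by (simp_all add: cheb_map_eq[of s])
  have W: "cheb (=) s v = cheb (=) s v2 * ?U"
    using cheb_replicate_append[OF v2, of s m] by (simp only: v[symmetric])
  show ?case
  proof (cases "v2 = []")
    case True
    then show ?thesis using U W by (intro exI[of _ "[b]"] exI[of _ "[?U]"]) (auto simp: b_def)
  next
    case False
    have "length v2 < length v" using m by (subst v) simp
    from less.hyps[OF this False] obtain "is" as where h: "is \<noteq> []" "length as = length is"
      "distinct_adj is" "last is = hd v2"
      "\<And>j. j<length is \<Longrightarrow> as ! j \<in> star_subalgebra hull {s (is ! j)} \<and> \<phi> (as ! j) = 0"
      "prod_list as = cheb (=) s v2" by blast
    have "distinct_adj (is @ [b])"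
      using h v2 False by (auto simp: distinct_adj_append_iff)
    moreover have "prod_list (as @ [?U]) = cheb (=) s v" using h(6) W by simp
    moreover have "(as @ [?U]) ! j \<in> star_subalgebra hull {s ((is @ [b]) ! j)} \<and> \<phi> ((as @ [?U]) ! j) = 0"
      if "j < length (is @ [b])" for j
    proof (cases "j < length is")
      case True
      then show ?thesis using h(5)[of j] h(2) by (simp add: nth_append)
    next
      case False
      then have "j = length is" using that by simp
      then show ?thesis using U h(2) by (simp add: nth_append)
    qed
    ultimately show ?thesis using h(2)
      by (intro exI[of _ "is @ [b]"] exI[of _ "as @ [?U]"]) (simp add: b_def)
  qed
qed

lemma free_semicircular_cheb:
  assumes "\<And>b. semicircular (s b)" "freely_independent UNIV s" "v \<noteq> []"
  shows "\<phi> (cheb (=) s v) = 0"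
proof -
  obtain "is" as where h: "is \<noteq> []" "length as = length is" "distinct_adj is"
    "\<forall>j<length is. as ! j \<in> star_subalgebra hull {s (is ! j)} \<and> \<phi> (as ! j) = 0"
    "prod_list as = cheb (=) s v"
    using cheb_eq_alternating_product[of s v, OF assms(1,3)] by blast
  have "\<phi> (prod_list as) = 0"
    using assms(2)[unfolded freely_independent_def free_subalgebras_def, rule_format, of "is" as] h
    by simp
  then show ?thesis using h(5) by simp
qed

lemma circular_moment:
  assumes "circular c"
  shows "\<phi> (prod_list (map (letter_apply star c) w)) = of_nat (pairing_count (\<noteq>) w [])"
proof -
  obtain s1 s2 where s: "semicircular s1" "semicircular s2"
    "freely_independent UNIV (\<lambda>b :: bool. if b then s1 else s2)"
    "c = scale (1 / complex_of_real (sqrt 2)) (s1 + scale \<i> s2)"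
    using assms unfolding circular_def by blast
  define s where "s = (\<lambda>b. if b then s1 else s2)"
  define z where "z = 1 / complex_of_real (sqrt 2)"
  have zz: "z * z = 1 / 2"
    unfolding z_def by (simp flip: of_real_mult)
  \<comment> \<open>Coordinates of \<open>c\<close> and its adjoint in \<open>s1\<close>,
    \<open>s2\<close>. Their bilinear products, without conjugation, are
    \<open>z * z + (z * \<i>) * (z * \<i>) = 0\<close> for equal letters and
    \<open>2 * z * z = 1\<close> for opposite ones, which is the covariance
    \<open>\<noteq>\<close>.\<close>
  define K where "K p b = (if b then z else if p = One then z * \<i> else - (z * \<i>))" for p b
  have "star c = scale z (s1 + scale (- \<i>) s2)"
    using s(1,2) unfolding s(4) semicircular_def
    by (simp add: star_scale star_add z_def)
  then have u: "letter_apply star c p = scale (K p True) (s True) + scale (K p False) (s False)" for p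
    using s(4) by (cases p)
      (simp_all add: K_def s_def z_def scale_right_distrib scale_right_diff_distrib)
  have K: "K p True * K q True + K p False * K q False = (if p \<noteq> q then 1 else 0)" for p q
  proof -
    have "z * \<i> * (z * \<i>) = - (z * z)"
      by (metis i_squared mult.assoc mult.left_commute mult_minus1_right)
    then show ?thesis
      by (cases p; cases q) (simp_all add: K_def zz)
  qed
  have "\<phi> (cheb (\<noteq>) (letter_apply star c) v) = 0" if "v \<noteq> []" for v
    unfolding cheb_expand[of "letter_apply star c" K s "(\<noteq>)", OF u K]
  proof (rule state_expand_eq_0)
    fix t :: "bool list" assume "length t = length v"
    with that have "t \<noteq> []" by auto
    then show "\<phi> (cheb (=) s t) = 0"
      using s by (intro free_semicircular_cheb) (auto simp: s_def)
  qed
  from state_prod_list[OF this, of "[]" w] show ?thesis by simp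
qed

end

section \<open>Counting walks\<close>

text \<open>Walks are total functions, frozen outside a window of \<open>d\<close> free vertices.
  This keeps the set finite and lets a partly chosen walk be continued one vertex at a time.\<close>

definition extensions :: "nat \<Rightarrow> nat \<Rightarrow> nat \<Rightarrow> (nat \<Rightarrow> nat) \<Rightarrow> (nat \<Rightarrow> nat) set" where
  "extensions n j d i = {i'. (\<forall>l\<in>{j..<j+d}. i' l < n) \<and> (\<forall>l. l \<notin> {j..<j+d} \<longrightarrow> i' l = i l)}"

lemma extensions_0 [simp]: "extensions n j 0 i = {i}"
  by (auto simp: extensions_def)

lemma extensions_Suc: "extensions n j (Suc d) i = (\<Union>v<n. extensions n (Suc j) d (i(j := v)))"
proof (intro equalityI subsetI)
  fix i' assume "i' \<in> extensions n j (Suc d) i"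
  then show "i' \<in> (\<Union>v<n. extensions n (Suc j) d (i(j := v)))"
    by (intro UN_I[of "i' j"]) (auto simp: extensions_def)
next
  fix i' assume "i' \<in> (\<Union>v<n. extensions n (Suc j) d (i(j := v)))"
  then obtain v where v: "v < n" "i' \<in> extensions n (Suc j) d (i(j := v))" by blast
  then have h: "\<And>l. l \<in> {Suc j..<Suc j+d} \<Longrightarrow> i' l < n"
    "\<And>l. l \<notin> {Suc j..<Suc j+d} \<Longrightarrow> i' l = (i(j := v)) l"
    by (auto simp: extensions_def)
  show "i' \<in> extensions n j (Suc d) i"
    unfolding extensions_def
  proof (intro CollectI conjI ballI allI impI)
    fix l assume "l \<in> {j..<j + Suc d}"
    then show "i' l < n" using h(1)[of l] h(2)[of j] v(1) by (cases "l = j") auto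
  next
    fix l assume "l \<notin> {j..<j + Suc d}"
    then show "i' l = i l" using h(2)[of l] by auto
  qed
qed

lemma finite_extensions [simp]: "finite (extensions n j d i)"
  by (induction d arbitrary: j i) (simp_all add: extensions_Suc)

lemma extensions_outside:
  "i' \<in> extensions n j d i \<Longrightarrow> l < j \<or> j + d \<le> l \<Longrightarrow> i' l = i l"
  by (auto simp: extensions_def)

lemma extensions_inside:
  "i' \<in> extensions n j d i \<Longrightarrow> j \<le> l \<Longrightarrow> l < j + d \<Longrightarrow> i' l < n"
  by (auto simp: extensions_def)

lemma sum_extensions_Suc:
  "sum F (extensions n j (Suc d) i) = (\<Sum>v<n. sum F (extensions n (Suc j) d (i(j := v))))"
  unfolding extensions_Suc
proof (rule sum.UNION_disjoint)
  show "\<forall>v\<in>{..<n}. \<forall>w\<in>{..<n}. v \<noteq> w \<longrightarrow>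
      extensions n (Suc j) d (i(j := v)) \<inter> extensions n (Suc j) d (i(j := w)) = {}"
  proof (intro ballI impI equals0I)
    fix v w i' assume "v \<noteq> w"
      and "i' \<in> extensions n (Suc j) d (i(j := v)) \<inter> extensions n (Suc j) d (i(j := w))"
    then show False
      using extensions_outside[of i' n "Suc j" d "i(j := v)" j]
        extensions_outside[of i' n "Suc j" d "i(j := w)" j] by simp
  qed
qed auto

text \<open>
  The number of ways to read the steps \<open>j, \<dots>, j + d - 1\<close> of the walk \<open>i\<close> as a depth-first traversal,
  where the stack holds the steps that have not been retraced yet.
\<close>

fun runs :: "(nat \<Rightarrow> 'b) \<Rightarrow> (nat \<Rightarrow> nat) \<Rightarrow> nat \<Rightarrow> nat \<Rightarrow> nat list \<Rightarrow> nat" where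
  "runs e i 0 j st = (if st = [] then 1 else 0)"
| "runs e i (Suc d) j st = runs e i d (Suc j) (j # st) +
     (case st of [] \<Rightarrow> 0
      | m # st' \<Rightarrow> if e j \<noteq> e m \<and> i (Suc j) = i m then runs e i d (Suc j) st' else 0)"

lemma runs_le: "runs e i d j st \<le> 2 ^ d"
proof (induction d arbitrary: j st)
  case (Suc d)
  show ?case using Suc[of "Suc j" "j # st"] Suc[of "Suc j" "tl st"]
    by (auto split: list.splits)
qed auto

text \<open>A push leaves the new vertex free and costs a factor \<open>n\<close>; a pop forces it
  to be the earlier vertex \<open>i m\<close>. Emptying the stack in \<open>d\<close> steps takes
  \<open>(d - length st) / 2\<close> pushes. If this is not a natural number, the pairing count is
  0.\<close>

lemma sum_runs:
  assumes "n > 0" "\<And>m. m \<in> set st \<Longrightarrow> m < j" "\<And>l. l \<le> j \<Longrightarrow> i l < n"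
  shows "(\<Sum>i'\<in>extensions n (Suc j) d i. real (runs e i' d j st)) =
     real (pairing_count (\<noteq>) (map e [j..<j+d]) (map e st)) * real n powr ((real d - real (length st)) / 2)"
  using assms(2,3)
proof (induction d arbitrary: j st i)
  case 0
  then show ?case using assms(1) by simp
next
  case (Suc d)
  let ?N = "\<lambda>st. real (pairing_count (\<noteq>) (map e [Suc j..<Suc j+d]) (map e st))"
  let ?X = "\<lambda>v. extensions n (Suc (Suc j)) d (i(Suc j := v))"
  have IH: "(\<Sum>i'\<in>?X v. real (runs e i' d (Suc j) st')) =
      ?N st' * real n powr ((real d - real (length st')) / 2)"
    if "v < n" "\<And>m. m \<in> set st' \<Longrightarrow> m < Suc j" for v st'
    by (rule Suc.IH) (use that Suc.prems(2) in auto)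
  have upt: "[j..<j + Suc d] = j # [Suc j..<Suc j + d]"
    by (simp add: upt_rec[of j])
  have push: "(\<Sum>v<n. \<Sum>i'\<in>?X v. real (runs e i' d (Suc j) (j # st))) =
      ?N (j # st) * real n powr ((real (Suc d) - real (length st)) / 2)"
  proof -
    have "(\<Sum>v<n. \<Sum>i'\<in>?X v. real (runs e i' d (Suc j) (j # st))) =
        (\<Sum>v<n. ?N (j # st) * real n powr ((real d - real (length (j # st))) / 2))"
      using Suc.prems(1) by (intro sum.cong refl IH) (auto simp: less_SucI)
    also have "\<dots> = ?N (j # st) * (real n powr 1 * real n powr ((real d - real (length (j # st))) / 2))"
      using assms(1) by simp
    also have "real n powr 1 * real n powr ((real d - real (length (j # st))) / 2) =
        real n powr ((real (Suc d) - real (length st)) / 2)"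
      unfolding powr_add[symmetric] by (simp add: field_simps)
    finally show ?thesis .
  qed
  have split: "(\<Sum>i'\<in>extensions n (Suc j) (Suc d) i. real (runs e i' (Suc d) j st)) =
      (\<Sum>v<n. \<Sum>i'\<in>?X v. real (runs e i' d (Suc j) (j # st))) +
      (\<Sum>v<n. \<Sum>i'\<in>?X v. real (case st of [] \<Rightarrow> 0
      | m # st' \<Rightarrow> if e j \<noteq> e m \<and> i' (Suc j) = i' m then runs e i' d (Suc j) st' else 0))"
    by (simp add: sum_extensions_Suc sum.distrib)
  show ?case
  proof (cases st)
    case Nil
    then show ?thesis unfolding split push upt by simp
  next
    case (Cons m st')
    have m: "m < j" "i m < n" "\<And>m. m \<in> set st' \<Longrightarrow> m < Suc j"
      using Suc.prems(1)[of m] Suc.prems(1) Suc.prems(2)[OF less_imp_le, of m] Cons by (auto simp: less_SucI)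
    have "(\<Sum>v<n. \<Sum>i'\<in>?X v. real (case st of [] \<Rightarrow> 0
      | m # st' \<Rightarrow> if e j \<noteq> e m \<and> i' (Suc j) = i' m then runs e i' d (Suc j) st' else 0)) =
      (\<Sum>v<n. if v = i m then if e j \<noteq> e m then \<Sum>i'\<in>?X v. real (runs e i' d (Suc j) st') else 0 else 0)"
    proof (intro sum.cong refl)
      fix v
      have eq: "i' (Suc j) = v" "i' m = i m" if "i' \<in> ?X v" for i'
        using extensions_outside[OF that, of "Suc j"] extensions_outside[OF that, of m] m(1) by auto
      show "(\<Sum>i'\<in>?X v. real (case st of [] \<Rightarrow> 0
        | m # st' \<Rightarrow> if e j \<noteq> e m \<and> i' (Suc j) = i' m then runs e i' d (Suc j) st' else 0)) =
        (if v = i m then if e j \<noteq> e m then \<Sum>i'\<in>?X v. real (runs e i' d (Suc j) st') else 0 else 0)"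
      proof -
        have "(\<Sum>i'\<in>?X v. real (case st of [] \<Rightarrow> 0
          | m # st' \<Rightarrow> if e j \<noteq> e m \<and> i' (Suc j) = i' m then runs e i' d (Suc j) st' else 0)) =
          (\<Sum>i'\<in>?X v. if v = i m then if e j \<noteq> e m then real (runs e i' d (Suc j) st') else 0 else 0)"
        proof (rule sum.cong[OF refl])
          fix i' assume "i' \<in> ?X v"
          then have "i' (Suc j) = v" "i' m = i m" by (rule eq)+
          then show "real (case st of [] \<Rightarrow> 0
              | m # st' \<Rightarrow> if e j \<noteq> e m \<and> i' (Suc j) = i' m then runs e i' d (Suc j) st' else 0) =
            (if v = i m then if e j \<noteq> e m then real (runs e i' d (Suc j) st') else 0 else 0)"
            by (simp only: Cons list.case) simp
        qed
        then show ?thesis by simp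
      qed
    qed
    also have "\<dots> = (if e j \<noteq> e m then \<Sum>i'\<in>?X (i m). real (runs e i' d (Suc j) st') else 0)"
      using m(2) by (subst sum.delta) auto
    also have "\<dots> = (if e j \<noteq> e m then ?N st' * real n powr ((real d - real (length st')) / 2) else 0)"
      using IH[OF m(2,3)] by simp
    also have "(real d - real (length st')) / 2 = (real (Suc d) - real (length st)) / 2"
      using Cons by simp
    finally show ?thesis unfolding split push upt
      by (cases "e j \<noteq> e m") (simp_all only: Cons list.map pairing_count.simps list.case
          if_True if_False simp_thms of_nat_add of_nat_0 distrib_right add_0_right)
  qed
qed

section \<open>Depth-first readings and pairings of steps\<close>

definition opposite_steps :: "(nat \<Rightarrow> 'b) \<Rightarrow> (nat \<Rightarrow> nat) \<Rightarrow> nat \<Rightarrow> nat \<Rightarrow> bool" where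
  "opposite_steps e i m l \<longleftrightarrow> e m \<noteq> e l \<and> i (Suc l) = i m \<and> i l = i (Suc m)"

lemma opposite_steps_sym: "opposite_steps e i m l \<longleftrightarrow> opposite_steps e i l m"
  by (auto simp: opposite_steps_def)

text \<open>The steps on the stack, from the top down, lead from the current vertex \<open>u\<close>
  back to the start. A pop in \<open>runs\<close> tests only one endpoint; this invariant supplies
  the other one, so that the popped step is truly retraced.\<close>

fun stack_path :: "(nat \<Rightarrow> nat) \<Rightarrow> nat \<Rightarrow> nat list \<Rightarrow> bool" where
  "stack_path i u [] \<longleftrightarrow> u = i 0"
| "stack_path i u (m # st) \<longleftrightarrow> u = i (Suc m) \<and> stack_path i (i m) st"

text \<open>A nonzero count contains a complete reading, in which every step is pushed and later
  popped or pops an earlier one. For the induction, partners may also lie on the initial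
  stack.\<close>

lemma runs_nonzero:
  assumes "runs e i d j st \<noteq> 0" "stack_path i (i j) st" "\<And>m. m \<in> set st \<Longrightarrow> m < j"
  shows "i (j + d) = i 0 \<and>
    (\<forall>m\<in>set st. \<exists>l. j \<le> l \<and> l < j + d \<and> opposite_steps e i m l) \<and>
    (\<forall>l. j \<le> l \<and> l < j + d \<longrightarrow>
      (\<exists>l'. l' \<noteq> l \<and> (j \<le> l' \<and> l' < j + d \<or> l' \<in> set st) \<and> opposite_steps e i l l'))"
  using assms
proof (induction d arbitrary: j st)
  case 0
  then show ?case by (auto split: if_splits)
next
  case (Suc d)
  consider (push) "runs e i d (Suc j) (j # st) \<noteq> 0"
    | (pop) m st' where "st = m # st'" "e j \<noteq> e m" "i (Suc j) = i m" "runs e i d (Suc j) st' \<noteq> 0"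
    using Suc.prems(1) by (auto split: list.splits if_splits)
  then show ?case
  proof cases
    case push
    have "stack_path i (i (Suc j)) (j # st)" "\<And>m. m \<in> set (j # st) \<Longrightarrow> m < Suc j"
      using Suc.prems by (auto simp: less_SucI)
    note H = Suc.IH[OF push this]
    have IH: "i (Suc j + d) = i 0"
      "\<And>m. m \<in> set (j # st) \<Longrightarrow> \<exists>l. Suc j \<le> l \<and> l < Suc j + d \<and> opposite_steps e i m l"
      "\<And>l. Suc j \<le> l \<and> l < Suc j + d \<Longrightarrow>
        \<exists>l'. l' \<noteq> l \<and> (Suc j \<le> l' \<and> l' < Suc j + d \<or> l' \<in> set (j # st)) \<and> opposite_steps e i l l'"
      using H by blast+
    show ?thesis
    proof (intro conjI ballI allI impI)
      fix m assume "m \<in> set st"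
      then show "\<exists>l. j \<le> l \<and> l < j + Suc d \<and> opposite_steps e i m l"
        using IH(2)[of m] by (metis Suc_leD add_Suc_shift list.set_intros(2))
    next
      fix l assume l: "j \<le> l \<and> l < j + Suc d"
      show "\<exists>l'. l' \<noteq> l \<and> (j \<le> l' \<and> l' < j + Suc d \<or> l' \<in> set st) \<and> opposite_steps e i l l'"
      proof (cases "l = j")
        case True
        obtain l' where "Suc j \<le> l'" "l' < Suc j + d" "opposite_steps e i j l'" using IH(2)[of j] by auto
        then show ?thesis using True by (intro exI[of _ l']) auto
      next
        case False
        then obtain l' where "l' \<noteq> l" "Suc j \<le> l' \<and> l' < Suc j + d \<or> l' \<in> set (j # st)" "opposite_steps e i l l'"
          using IH(3)[of l] l by auto
        then show ?thesis by (intro exI[of _ l']) auto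
      qed
    qed (use IH(1) in auto)
  next
    case pop
    have R: "opposite_steps e i m j"
      using pop Suc.prems(2) by (auto simp: opposite_steps_def)
    have mj: "m < j" using Suc.prems(3) pop by auto
    have "stack_path i (i (Suc j)) st'" "\<And>m. m \<in> set st' \<Longrightarrow> m < Suc j"
      using Suc.prems pop by (auto simp: less_SucI)
    note H = Suc.IH[OF pop(4) this]
    have IH: "i (Suc j + d) = i 0"
      "\<And>m. m \<in> set st' \<Longrightarrow> \<exists>l. Suc j \<le> l \<and> l < Suc j + d \<and> opposite_steps e i m l"
      "\<And>l. Suc j \<le> l \<and> l < Suc j + d \<Longrightarrow>
        \<exists>l'. l' \<noteq> l \<and> (Suc j \<le> l' \<and> l' < Suc j + d \<or> l' \<in> set st') \<and> opposite_steps e i l l'"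
      using H by blast+
    show ?thesis
    proof (intro conjI ballI allI impI)
      fix m' assume "m' \<in> set st"
      then show "\<exists>l. j \<le> l \<and> l < j + Suc d \<and> opposite_steps e i m' l"
        using IH(2)[of m'] R pop(1) by (cases "m' = m") (auto dest: Suc_leD)
    next
      fix l assume l: "j \<le> l \<and> l < j + Suc d"
      show "\<exists>l'. l' \<noteq> l \<and> (j \<le> l' \<and> l' < j + Suc d \<or> l' \<in> set st) \<and> opposite_steps e i l l'"
      proof (cases "l = j")
        case True
        then show ?thesis using R mj pop(1) opposite_steps_sym[of e i m j] by (intro exI[of _ m]) auto
      next
        case False
        then obtain l' where "l' \<noteq> l" "Suc j \<le> l' \<and> l' < Suc j + d \<or> l' \<in> set st'" "opposite_steps e i l l'"
          using IH(3)[of l] l by auto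
        then show ?thesis using pop(1) by (intro exI[of _ l']) auto
      qed
    qed (use IH(1) in auto)
  qed
qed

text \<open>At each step exactly one of push and pop can be completed, and \<open>f\<close> tells
  which: push if the partner is still to come, pop if it is past. The stack holds the steps whose
  partner has not been read.\<close>

lemma runs_eq_1:
  assumes f: "\<And>j. j < k \<Longrightarrow> f j < k" "\<And>j. j < k \<Longrightarrow> f j \<noteq> j" "\<And>j. j < k \<Longrightarrow> f (f j) = j"
    and R: "\<And>j. j < k \<Longrightarrow> opposite_steps e i j (f j)"
    and unique: "\<And>j l. j < k \<Longrightarrow> l < k \<Longrightarrow> l \<noteq> j \<Longrightarrow> opposite_steps e i j l \<Longrightarrow> l = f j"
    and noncrossing: "\<And>j m. j < k \<Longrightarrow> f j < m \<Longrightarrow> m < j \<Longrightarrow> f m < j"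
    and st: "set st = {m. m < j \<and> j \<le> f m}" "sorted_wrt (>) st" "stack_path i (i j) st" "j + d = k"
  shows "runs e i d j st = 1"
  using st
proof (induction d arbitrary: j st)
  case 0
  have "set st = {}" unfolding 0(1) using f(1) 0(4) by (fastforce simp: not_le)
  then show ?case by simp
next
  case (Suc d)
  have jk: "j < k" using Suc.prems by simp
  show ?case
  proof (cases "f j < j")
    case False
    then have fj: "j < f j" using f(2)[OF jk] by linarith
    have ne: "f m \<noteq> j" if "m < j" for m using f(3)[of m] that fj jk by fastforce
    have "set (j # st) = {m. m < Suc j \<and> Suc j \<le> f m}"
      using Suc.prems(1) fj ne by (force simp: less_Suc_eq Suc_le_eq order_le_less)
    moreover have "sorted_wrt (>) (j # st)" using Suc.prems(1,2) by auto
    ultimately have push: "runs e i d (Suc j) (j # st) = 1"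
      using Suc.prems by (intro Suc.IH) auto
    \<comment> \<open>Popping would make \<open>j\<close> opposite to the top \<open>m\<close>,
      hence \<open>j = f m\<close> by uniqueness; but the partner of \<open>j\<close> lies
      ahead.\<close>
    have "\<not> (e j \<noteq> e m \<and> i (Suc j) = i m)" if "st = m # st'" for m st'
    proof
      assume "e j \<noteq> e m \<and> i (Suc j) = i m"
      then have "opposite_steps e i m j" using Suc.prems(3) that by (auto simp: opposite_steps_def)
      moreover have "m < j" using Suc.prems(1) that by auto
      ultimately show False using unique[of m j] ne[of m] jk by auto
    qed
    then show ?thesis using push by (auto split: list.splits)
  next
    case True
    then have mem: "f j \<in> set st" using f(3)[OF jk] Suc.prems(1) by simp
    then obtain m st' where m: "st = m # st'" by (cases st) auto
    \<comment> \<open>By noncrossing, everything pushed after \<open>f j\<close> has been closed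
      before \<open>j\<close>, so \<open>f j\<close> is on top.\<close>
    have "m = f j"
    proof (rule ccontr)
      assume ne: "m \<noteq> f j"
      then have "f j < m" using mem m Suc.prems(2) by auto
      moreover have "m < j" "j \<le> f m" using Suc.prems(1) m by auto
      ultimately show False using noncrossing[OF jk, of m] by auto
    qed
    then have Rj: "opposite_steps e i j m" using R[OF jk] by simp
    have "m \<notin> set st'" using Suc.prems(2) m by auto
    then have "set st' = set st - {f j}" using m \<open>m = f j\<close> by auto
    also have "\<dots> = {m. m < Suc j \<and> Suc j \<le> f m}"
      unfolding Suc.prems(1) using True f(3)[OF jk] f(3) jk
      by (auto simp: less_Suc_eq Suc_le_eq order_le_less)
    finally have "set st' = {m. m < Suc j \<and> Suc j \<le> f m}" .
    moreover have ij: "i (Suc j) = i m" "e j \<noteq> e m" using Rj by (auto simp: opposite_steps_def)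
    ultimately have pop: "runs e i d (Suc j) st' = 1"
      using Suc.prems m by (intro Suc.IH) auto
    \<comment> \<open>Once pushed, \<open>j\<close> would need an opposite step after it, but its
      only opposite step \<open>f j\<close> comes before.\<close>
    have "runs e i d (Suc j) (j # st) = 0"
    proof (rule ccontr)
      assume "runs e i d (Suc j) (j # st) \<noteq> 0"
      moreover have "stack_path i (i (Suc j)) (j # st)" using Suc.prems(3) by simp
      moreover have "\<And>m. m \<in> set (j # st) \<Longrightarrow> m < Suc j"
        unfolding set_simps Suc.prems(1) by auto
      ultimately obtain l where l: "Suc j \<le> l" "l < Suc j + d" "opposite_steps e i j l"
        using runs_nonzero[of e i d "Suc j" "j # st"] by (meson list.set_intros(1))
      then have "l = f j" using Suc.prems(4) by (intro unique[OF jk]) auto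
      then show False using l(1) True by simp
    qed
    then show ?thesis using pop m ij by simp
  qed
qed

section \<open>Linear relations among the differences\<close>

primrec letter_sign :: "letter \<Rightarrow> int" where
  "letter_sign One = 1"
| "letter_sign Adj = -1"

lemma letter_sign_square [simp]: "letter_sign a * letter_sign a = 1"
  by (cases a) auto

text \<open>The index of \<open>x\<close> in the matrix entry that step \<open>j\<close> visits: the
  adjoint swaps row and column, which negates the difference and leaves the sum alone.\<close>

definition step_diff :: "(nat \<Rightarrow> letter) \<Rightarrow> (nat \<Rightarrow> nat) \<Rightarrow> nat \<Rightarrow> int" where
  "step_diff e i j = letter_sign (e j) * (int (i j) - int (i (Suc j)))"

definition step_sum :: "(nat \<Rightarrow> nat) \<Rightarrow> nat \<Rightarrow> int" where
  "step_sum i j = int (i j) + int (i (Suc j))"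

abbreviation walks :: "nat \<Rightarrow> nat \<Rightarrow> (nat \<Rightarrow> nat) set" where
  "walks n k \<equiv> extensions n 0 (Suc k) (\<lambda>_. 0)"

text \<open>\<open>p\<close> merges steps with equal differences. The sign cancels the one inside
  \<open>step_diff\<close>, so \<open>q\<close> weighs the plain increments
  \<open>i m - i (Suc m)\<close>.\<close>

definition dependent_walks ::
    "nat \<Rightarrow> nat \<Rightarrow> (nat \<Rightarrow> letter) \<Rightarrow> (nat \<Rightarrow> nat) \<Rightarrow> (nat \<Rightarrow> int) \<Rightarrow> (nat \<Rightarrow> nat) set" where
  "dependent_walks n k e p q = {i \<in> walks n k. (\<forall>j<k. step_diff e i j = step_diff e i (p j)) \<and>
     (\<Sum>m<k. q m * letter_sign (e m) * step_diff e i m) = 0}"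

text \<open>
  These weights make the relation in \<open>dependent_walks\<close> read \<open>step_sum i j = step_sum i l\<close>; the
  constant weight 1 in \<open>weights\<close> makes it express that the walk is closed.
\<close>

definition interval_weight :: "nat \<Rightarrow> nat \<Rightarrow> nat \<Rightarrow> int" where
  "interval_weight j l m = of_bool (j \<le> m \<and> m < l) + of_bool (j < m \<and> m \<le> l)"

definition weights :: "nat \<Rightarrow> (nat \<Rightarrow> int) set" where
  "weights k = {\<lambda>_. 0, \<lambda>_. 1} \<union> (\<lambda>(j, l). interval_weight j l) ` ({..<k} \<times> {..<k})"

text \<open>
  The differences selected by \<open>p\<close> are too few, or satisfy a nontrivial linear relation.
\<close>

definition degenerate :: "nat \<Rightarrow> (nat \<Rightarrow> letter) \<Rightarrow> (nat \<Rightarrow> nat) \<Rightarrow> (nat \<Rightarrow> int) \<Rightarrow> bool" where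
  "degenerate k e p q \<longleftrightarrow> 2 * card (p ` {..<k}) < k \<or>
     2 * card (p ` {..<k}) \<le> k \<and>
     (\<exists>t\<in>p ` {..<k}. (\<Sum>m | m < k \<and> p m = t. q m * letter_sign (e m)) \<noteq> 0)"

text \<open>The index set is finite and independent of \<open>n\<close>, so a bound for each pair
  \<open>(p, q)\<close> bounds the union up to a constant.\<close>

definition bad_walks :: "nat \<Rightarrow> nat \<Rightarrow> (nat \<Rightarrow> letter) \<Rightarrow> (nat \<Rightarrow> nat) set" where
  "bad_walks n k e = (\<Union>(p, q)\<in>{(p, q). p \<in> {..<k} \<rightarrow>\<^sub>E {..<k} \<and> q \<in> weights k \<and> degenerate k e p q}.
     dependent_walks n k e p q)"

text \<open>There are \<open>n\<close> starting points, and each difference lies in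
  \<open>{-int n..<int n}\<close>, which has \<open>2 * n\<close> elements.\<close>

lemma card_determined_walks:
  assumes "X \<subseteq> walks n k" "T \<subseteq> {..<k}"
    and "\<And>i i'. i \<in> X \<Longrightarrow> i' \<in> X \<Longrightarrow> i 0 = i' 0 \<Longrightarrow>
      (\<And>t. t \<in> T \<Longrightarrow> step_diff e i t = step_diff e i' t) \<Longrightarrow> i = i'"
  shows "card X \<le> n * (2 * n) ^ card T"
proof -
  have T: "finite T" using assms(2) finite_subset by blast
  let ?g = "\<lambda>i. (i 0, restrict (step_diff e i) T)"
  let ?Y = "{..<n} \<times> (T \<rightarrow>\<^sub>E {-int n..<int n})"
  have "card X \<le> card ?Y"
  proof (rule card_inj_on_le[of ?g])
    show "inj_on ?g X"
    proof (rule inj_onI)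
      fix i i' assume i: "i \<in> X" "i' \<in> X" "?g i = ?g i'"
      have "step_diff e i t = step_diff e i' t" if "t \<in> T" for t
      proof -
        have "restrict (step_diff e i) T t = restrict (step_diff e i') T t" using i(3) by simp
        then show ?thesis using that by simp
      qed
      then show "i = i'" using i by (intro assms(3)) auto
    qed
    show "?g ` X \<subseteq> ?Y"
    proof
      fix y assume "y \<in> ?g ` X"
      then obtain i where i: "i \<in> walks n k" "y = ?g i" using assms(1) by auto
      have "step_diff e i t \<in> {-int n..<int n}" if "t \<in> T" for t
      proof -
        have "i t < n" "i (Suc t) < n"
          using extensions_inside[OF i(1), of t] extensions_inside[OF i(1), of "Suc t"] that assms(2) by auto
        then show ?thesis by (cases "e t") (auto simp: step_diff_def)
      qed
      then show "y \<in> ?Y" using extensions_inside[OF i(1), of 0] i(2) by auto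
    qed
    show "finite ?Y" using T by (intro finite_cartesian_product finite_PiE) auto
  qed
  also have "\<dots> = n * (2 * n) ^ card T"
  proof -
    have "card {-int n..<int n} = 2 * n" by simp
    then show ?thesis using T
      by (simp only: card_cartesian_product card_PiE card_lessThan prod_constant)
  qed
  finally show ?thesis .
qed

lemma walks_determined:
  assumes "i \<in> walks n k" "i' \<in> walks n k" "i 0 = i' 0"
    "\<And>j. j < k \<Longrightarrow> step_diff e i j = step_diff e i' j"
  shows "i = i'"
proof
  have le: "i j = i' j" if "j \<le> k" for j
    using that
  proof (induction j)
    case (Suc j)
    then have "step_diff e i j = step_diff e i' j" "i j = i' j" using assms(4)[of j] by auto
    then show ?case by (cases "e j") (auto simp: step_diff_def)
  qed (use assms(3) in simp)
  fix j
  show "i j = i' j"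
    using le[of j] extensions_outside[OF assms(1), of j] extensions_outside[OF assms(2), of j]
    by (cases "j \<le> k") auto
qed

text \<open>Start and class differences determine the walk. Either there are fewer than
  \<open>k / 2\<close> classes, or a relation with a nonzero coefficient at \<open>t0\<close>
  computes one difference from the others. Both ways, fewer than \<open>k / 2\<close> free
  differences remain, and \<open>(k - 1) div 2\<close> is the largest such number.\<close>

lemma card_dependent_walks:
  assumes "p \<in> {..<k} \<rightarrow>\<^sub>E {..<k}" "degenerate k e p q" "n > 0"
  shows "card (dependent_walks n k e p q) \<le> n * (2 * n) ^ ((k - 1) div 2)"
proof -
  define T where "T = p ` {..<k}"
  have T: "finite T" "T \<subseteq> {..<k}" using assms(1) by (auto simp: T_def)
  have mono: "n * (2 * n) ^ r \<le> n * (2 * n) ^ ((k - 1) div 2)" if "2 * r < k" for r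
    using that assms(3) by (intro mult_le_mono2 power_increasing) auto
  have eq: "step_diff e i j = step_diff e i (p j)" if "i \<in> dependent_walks n k e p q" "j < k" for i j
    using that by (auto simp: dependent_walks_def)
  have sub: "dependent_walks n k e p q \<subseteq> walks n k" by (auto simp: dependent_walks_def)
  have det: "i = i'" if "i \<in> dependent_walks n k e p q" "i' \<in> dependent_walks n k e p q" "i 0 = i' 0"
    "\<And>t. t \<in> T \<Longrightarrow> step_diff e i t = step_diff e i' t" for i i'
  proof (rule walks_determined)
    fix j assume "j < k"
    then show "step_diff e i j = step_diff e i' j"
      using eq[OF that(1), of j] eq[OF that(2), of j] that(4)[of "p j"] by (auto simp: T_def)
  qed (use that sub in auto)
  show ?thesis
  proof (cases "2 * card T < k")
    case True
    have "card (dependent_walks n k e p q) \<le> n * (2 * n) ^ card T"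
      by (rule card_determined_walks[OF sub T(2), of e]) (rule det)
    also have "\<dots> \<le> n * (2 * n) ^ ((k - 1) div 2)" using True by (rule mono)
    finally show ?thesis .
  next
    case False
    define a where "a t = (\<Sum>m | m < k \<and> p m = t. q m * letter_sign (e m))" for t
    obtain t0 where t0: "t0 \<in> T" "a t0 \<noteq> 0" and le: "2 * card T \<le> k"
      using assms(2) False by (auto simp: degenerate_def T_def a_def)
    have rel: "a t0 * step_diff e i t0 = - (\<Sum>t\<in>T - {t0}. a t * step_diff e i t)"
      if "i \<in> dependent_walks n k e p q" for i
    proof -
      have "0 = (\<Sum>m<k. q m * letter_sign (e m) * step_diff e i m)"
        using that unfolding dependent_walks_def mem_Collect_eq by (elim conjE) (rule sym)
      also have "\<dots> = (\<Sum>t\<in>T. \<Sum>m | m \<in> {..<k} \<and> p m = t. q m * letter_sign (e m) * step_diff e i m)"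
        unfolding T_def by (rule sum.image_gen) simp
      also have "\<dots> = (\<Sum>t\<in>T. a t * step_diff e i t)"
        unfolding a_def sum_distrib_right
        by (intro sum.cong refl) (use eq[OF that] in auto)
      also have "\<dots> = a t0 * step_diff e i t0 + (\<Sum>t\<in>T - {t0}. a t * step_diff e i t)"
        using T(1) t0(1) by (rule sum.remove)
      finally show ?thesis by simp
    qed
    have "card (dependent_walks n k e p q) \<le> n * (2 * n) ^ card (T - {t0})"
    proof (rule card_determined_walks[OF sub])
      fix i i' assume i: "i \<in> dependent_walks n k e p q" "i' \<in> dependent_walks n k e p q" "i 0 = i' 0"
        and d: "\<And>t. t \<in> T - {t0} \<Longrightarrow> step_diff e i t = step_diff e i' t"
      have "a t0 * step_diff e i t0 = a t0 * step_diff e i' t0"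
        unfolding rel[OF i(1)] rel[OF i(2)] using d by (intro arg_cong[of _ _ uminus] sum.cong) auto
      then have "step_diff e i t0 = step_diff e i' t0" using t0(2) by simp
      then show "i = i'" using d by (intro det i) auto
    qed (use T in auto)
    also have "\<dots> \<le> n * (2 * n) ^ ((k - 1) div 2)"
    proof (rule mono)
      have "card (T - {t0}) < card T" using T(1) t0(1) by (intro card_Diff1_less) auto
      then show "2 * card (T - {t0}) < k" using le by linarith
    qed
    finally show ?thesis .
  qed
qed

lemma card_bad_walks:
  "\<exists>C. \<forall>n>0. card (bad_walks n k e) \<le> C * (n * (2 * n) ^ ((k - 1) div 2))"
proof -
  let ?I = "{(p, q). p \<in> {..<k} \<rightarrow>\<^sub>E {..<k} \<and> q \<in> weights k \<and> degenerate k e p q}"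
  have "finite (({..<k} \<rightarrow>\<^sub>E {..<k}) \<times> weights k)"
    by (intro finite_cartesian_product finite_PiE) (auto simp: weights_def)
  then have I: "finite ?I" by (rule rev_finite_subset) auto
  have "card (bad_walks n k e) \<le> card ?I * (n * (2 * n) ^ ((k - 1) div 2))" if "n > 0" for n
  proof -
    have "card (bad_walks n k e) \<le> (\<Sum>z\<in>?I. card (case z of (p, q) \<Rightarrow> dependent_walks n k e p q))"
      unfolding bad_walks_def by (rule card_UN_le[OF I])
    also have "\<dots> \<le> (\<Sum>z\<in>?I. n * (2 * n) ^ ((k - 1) div 2))"
    proof (rule sum_mono)
      fix z assume "z \<in> ?I"
      then obtain p q where "z = (p, q)" "p \<in> {..<k} \<rightarrow>\<^sub>E {..<k}" "degenerate k e p q" by blast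
      then show "card (case z of (p, q) \<Rightarrow> dependent_walks n k e p q) \<le> n * (2 * n) ^ ((k - 1) div 2)"
        using card_dependent_walks[of p k e q n] that by simp
    qed
    finally show ?thesis by simp
  qed
  then show ?thesis by blast
qed

text \<open>The weight adds the increments over \<open>{j..<l}\<close> and over
  \<open>{Suc j..<Suc l}\<close>. The two telescoping sums give \<open>i j - i l\<close> and
  \<open>i (Suc j) - i (Suc l)\<close>.\<close>

lemma interval_weight_sum:
  assumes "j < l" "l < k"
  shows "(\<Sum>m<k. interval_weight j l m * letter_sign (e m) * step_diff e i m) = step_sum i j - step_sum i l"
proof -
  let ?g = "\<lambda>m. int (i m) - int (i (Suc m))"
  have tel: "(\<Sum>m=a..<b. ?g m) = int (i a) - int (i b)" if "a \<le> b" for a b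
    using sum_Suc_diff'[OF that, of "\<lambda>m. - int (i m)"] by simp
  have "(\<Sum>m<k. interval_weight j l m * letter_sign (e m) * step_diff e i m) =
      (\<Sum>m<k. of_bool (j \<le> m \<and> m < l) * ?g m) + (\<Sum>m<k. of_bool (j < m \<and> m \<le> l) * ?g m)"
    unfolding sum.distrib[symmetric]
  proof (intro sum.cong refl)
    fix m
    have "interval_weight j l m * letter_sign (e m) * step_diff e i m =
       interval_weight j l m * (letter_sign (e m) * letter_sign (e m)) * ?g m"
      unfolding step_diff_def by (simp only: mult.assoc)
    then show "interval_weight j l m * letter_sign (e m) * step_diff e i m =
       of_bool (j \<le> m \<and> m < l) * ?g m + of_bool (j < m \<and> m \<le> l) * ?g m"
      by (simp add: interval_weight_def distrib_right)
  qed
  also have "(\<Sum>m<k. of_bool (j \<le> m \<and> m < l) * ?g m) = (\<Sum>m=j..<l. ?g m)"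
    using assms by (intro sum.mono_neutral_cong_right) auto
  also have "(\<Sum>m<k. of_bool (j < m \<and> m \<le> l) * ?g m) = (\<Sum>m=Suc j..<Suc l. ?g m)"
    using assms by (intro sum.mono_neutral_cong_right) auto
  finally show ?thesis using assms by (simp only: tel) (simp add: tel step_sum_def)
qed

text \<open>
  Outside the bad walks every linear relation of the given kind holds identically in the free
  differences. For the closing relation this forces opposite letters in each pair; for
  \<open>step_sum i j = step_sum i l\<close> it forces \<open>l\<close> to be the partner of \<open>j\<close> and the steps in between
  to be paired among themselves.
\<close>

lemma good_walk_pairing:
  assumes i: "i \<in> walks n k" "i k = i 0" "i \<notin> bad_walks n k e"
    and diffs: "\<And>j. j < k \<Longrightarrow> \<exists>l<k. l \<noteq> j \<and> step_diff e i l = step_diff e i j"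
    and sums: "\<And>j. j < k \<Longrightarrow> \<exists>l<k. l \<noteq> j \<and> step_sum i l = step_sum i j"
  obtains f where "\<forall>j<k. f j < k" "\<forall>j<k. f j \<noteq> j" "\<forall>j<k. f (f j) = j"
    "\<forall>j<k. opposite_steps e i j (f j)"
    "\<forall>j<k. \<forall>l<k. l \<noteq> j \<longrightarrow> step_diff e i l = step_diff e i j \<longrightarrow> l = f j"
    "\<forall>j<k. \<forall>l<k. l \<noteq> j \<longrightarrow> step_sum i l = step_sum i j \<longrightarrow> l = f j"
    "\<forall>j<k. \<forall>m. f j < m \<longrightarrow> m < j \<longrightarrow> f m < j"
proof -
  let ?s = "\<lambda>j. letter_sign (e j)"
  let ?d = "step_diff e i"
  \<comment> \<open>The least step with the same difference represents its class; it is at most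
    \<open>j\<close>, so \<open>p\<close> stays within the index set of
    \<open>bad_walks\<close>.\<close>
  define p where "p = (\<lambda>j\<in>{..<k}. LEAST l. ?d l = ?d j)"
  define T where "T = p ` {..<k}"
  have dp: "?d (p j) = ?d j" and ple: "p j \<le> j" if "j < k" for j
    using LeastI[of "\<lambda>l. ?d l = ?d j" j, OF refl] Least_le[of "\<lambda>l. ?d l = ?d j" j, OF refl] that
    unfolding p_def by (simp_all only: restrict_apply lessThan_iff if_True)
  have p: "p \<in> {..<k} \<rightarrow>\<^sub>E {..<k}"
  proof (rule PiE_I)
    fix j assume "j \<in> {..<k}"
    then show "p j \<in> {..<k}" using ple[of j] by simp
  qed (simp add: p_def)
  have peq: "p j = p l \<longleftrightarrow> ?d j = ?d l" if "j < k" "l < k" for j l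
  proof
    assume "p j = p l"
    then show "?d j = ?d l" using dp[OF that(1)] dp[OF that(2)] by simp
  next
    assume "?d j = ?d l"
    then have "(\<lambda>m. ?d m = ?d j) = (\<lambda>m. ?d m = ?d l)" by (simp only:)
    then show "p j = p l" using that unfolding p_def by (simp only: restrict_apply lessThan_iff if_True)
  qed
  have fiber_ge: "2 \<le> card {m. m < k \<and> p m = t}" if t: "t \<in> T" for t
  proof -
    obtain j where j: "j < k" "t = p j" using t by (auto simp: T_def)
    obtain l where l: "l < k" "l \<noteq> j" "?d l = ?d j" using diffs[OF j(1)] by auto
    have "{j, l} \<subseteq> {m. m < k \<and> p m = t}" using j l peq by auto
    then have "card {j, l} \<le> card {m. m < k \<and> p m = t}" by (intro card_mono) auto
    then show ?thesis using l(2) by simp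
  qed
  have T: "finite T" by (simp add: T_def)
  have count: "k = (\<Sum>t\<in>T. card {m. m < k \<and> p m = t})"
    using sum.image_gen[of "{..<k}" "\<lambda>_. 1::nat" p] by (simp add: T_def)
  have cardT: "2 * card T \<le> k"
  proof -
    have "(\<Sum>t\<in>T. 2) \<le> (\<Sum>t\<in>T. card {m. m < k \<and> p m = t})"
      using fiber_ge by (rule sum_mono)
    then show ?thesis using count by simp
  qed
  have good: "\<not> degenerate k e p q" if "q \<in> weights k" "(\<Sum>m<k. q m * ?s m * ?d m) = 0" for q
  proof
    assume "degenerate k e p q"
    moreover have "i \<in> dependent_walks n k e p q"
      using that(2) i(1) dp by (auto simp: dependent_walks_def)
    ultimately have "i \<in> bad_walks n k e" using that(1) p unfolding bad_walks_def by blast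
    with i(3) show False by blast
  qed
  \<comment> \<open>Zero weights give a relation that every walk satisfies and reduce
    \<open>degenerate\<close> to its first alternative.\<close>
  have "\<not> 2 * card T < k" using good[of "\<lambda>_. 0"] by (auto simp: weights_def degenerate_def T_def)
  \<comment> \<open>Now \<open>2 * card T = k\<close>, while every class has at least two members:
    equality must hold class by class.\<close>
  with cardT count have eq: "(\<Sum>t\<in>T. 2) = (\<Sum>t\<in>T. card {m. m < k \<and> p m = t})" by simp
  have fiber_card: "2 = card {m. m < k \<and> p m = t}" if t: "t \<in> T" for t
    using sum_mono_inv[OF eq fiber_ge t T] by simp
  have "\<exists>l. l \<noteq> j \<and> {m. m < k \<and> p m = p j} = {j, l}" if j: "j < k" for j
  proof -
    have "card {m. m < k \<and> p m = p j} = 2" using fiber_card[of "p j"] j by (auto simp: T_def)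
    then obtain a b where ab: "a \<noteq> b" "{m. m < k \<and> p m = p j} = {a, b}" by (auto simp: card_2_iff)
    moreover have "j \<in> {a, b}" using ab(2) j by blast
    ultimately have "{m. m < k \<and> p m = p j} = {j, if j = a then b else a}" "(if j = a then b else a) \<noteq> j"
      by (auto simp only: insert_iff split: if_splits)
    then show ?thesis by blast
  qed
  then have "\<forall>j. \<exists>l. j < k \<longrightarrow> l \<noteq> j \<and> {m. m < k \<and> p m = p j} = {j, l}" by blast
  from choice[OF this] obtain f where
    f: "\<And>j. j < k \<Longrightarrow> f j \<noteq> j" and fiber: "\<And>j. j < k \<Longrightarrow> {m. m < k \<and> p m = p j} = {j, f j}"
    by blast
  have fk: "f j < k" and pf: "p (f j) = p j" if "j < k" for j
    using fiber[OF that] by blast+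
  have f_diff: "l = f j" if "j < k" "l < k" "l \<noteq> j" "?d l = ?d j" for j l
    using fiber[OF that(1)] that peq[OF that(2,1)] by blast
  have ff: "f (f j) = j" if "j < k" for j
    using f_diff[of "f j" j] fk[OF that] f[OF that] pf[OF that] that peq[of "f j" j] by simp
  have rel: "q j * ?s j + q (f j) * ?s (f j) = 0"
    if "q \<in> weights k" "(\<Sum>m<k. q m * ?s m * ?d m) = 0" "j < k" for q j
  proof -
    have "(\<Sum>m | m < k \<and> p m = p j. q m * ?s m) = 0"
      using good[OF that(1,2)] cardT that(3) by (auto simp: degenerate_def T_def)
    then show ?thesis unfolding fiber[OF that(3)] using f[OF that(3)] by simp
  qed
  have closing: "(\<Sum>m<k. 1 * ?s m * ?d m) = 0"
  proof -
    have "(\<Sum>m<k. 1 * ?s m * ?d m) = (\<Sum>m<k. int (i m) - int (i (Suc m)))"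
      by (simp add: step_diff_def flip: mult.assoc)
    also have "\<dots> = int (i 0) - int (i k)" by (rule sum_lessThan_telescope')
    finally show ?thesis using i(2) by simp
  qed
  have sf: "?s (f j) = - ?s j" if "j < k" for j
    using rel[OF _ closing that] by (simp add: weights_def)
  \<comment> \<open>The two steps of a pair carry opposite signs, so vanishing of the coefficient of
    their class means equal weights.\<close>
  have weight_f: "q (f j) = q j" if "q \<in> weights k" "(\<Sum>m<k. q m * ?s m * ?d m) = 0" "j < k" for q j
    using rel[OF that] sf[OF that(3)] by (cases "e j") auto
  have iw: "interval_weight a b (f m) = interval_weight a b m"
    if "a < b" "b < k" "step_sum i a = step_sum i b" "m < k" for a b m
    using that interval_weight_sum[OF that(1,2), of e i]
    by (intro weight_f) (auto simp: weights_def)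
  \<comment> \<open>The weight is 1 at both ends of the interval, 2 inside and 0 outside. Equal
    weights on a pair leave the other end as the only possible partner of \<open>j\<close>.\<close>
  have f_sum: "l = f j" if "j < k" "l < k" "l \<noteq> j" "step_sum i l = step_sum i j" for j l
  proof -
    have "interval_weight (min j l) (max j l) (f j) = interval_weight (min j l) (max j l) j"
      using that by (intro iw) (auto simp: min_def max_def)
    then show ?thesis using that f[OF that(1)]
      by (auto simp: interval_weight_def min_def max_def of_bool_def split: if_splits)
  qed
  have sum_f: "step_sum i (f j) = step_sum i j" if "j < k" for j
    using sums[OF that] f_sum[OF that] by metis
  have opp: "opposite_steps e i j (f j)" if j: "j < k" for j
  proof -
    have "?d (f j) = ?d j" using peq[of "f j" j] fk[OF j] j pf[OF j] by simp
    then show ?thesis using sum_f[OF j] sf[OF j]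
      by (cases "e j"; cases "e (f j)") (auto simp: opposite_steps_def step_diff_def step_sum_def)
  qed
  \<comment> \<open>Between \<open>f j\<close> and \<open>j\<close> the weight is 2, so the partner
    of an inner step is again an inner step.\<close>
  have nc: "f m < j" if j: "j < k" and m: "f j < m" "m < j" for j m
  proof -
    have "interval_weight (f j) j (f m) = interval_weight (f j) j m"
      using m j sum_f[OF j] by (intro iw) auto
    then show ?thesis using m by (auto simp: interval_weight_def of_bool_def split: if_splits)
  qed
  show ?thesis
  proof (rule that[of f])
    show "\<forall>j<k. f j < k" using fk by blast
    show "\<forall>j<k. f j \<noteq> j" using f by blast
    show "\<forall>j<k. f (f j) = j" using ff by blast
    show "\<forall>j<k. opposite_steps e i j (f j)" using opp by blast
    show "\<forall>j<k. \<forall>l<k. l \<noteq> j \<longrightarrow> ?d l = ?d j \<longrightarrow> l = f j" using f_diff by blast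
    show "\<forall>j<k. \<forall>l<k. l \<noteq> j \<longrightarrow> step_sum i l = step_sum i j \<longrightarrow> l = f j" using f_sum by blast
    show "\<forall>j<k. \<forall>m. f j < m \<longrightarrow> m < j \<longrightarrow> f m < j" using nc by blast
  qed
qed

section \<open>Mixed moments of admissible systems\<close>

lemma opposite_steps_eq:
  assumes "opposite_steps e i j l"
  shows "step_diff e i l = step_diff e i j" "step_sum i l = step_sum i j"
  using assms by (cases "e j"; cases "e l"; auto simp: opposite_steps_def step_diff_def step_sum_def)+

text \<open>Turns repeated indices into powers at distinct ones, the form in which
  \<open>SMS\<close> and \<open>admissible_SMS\<close> speak of products.\<close>

lemma prod_by_values:
  fixes g :: "nat \<Rightarrow> 'i"
  assumes "k \<ge> 1"
  obtains n :: nat and \<alpha> :: "nat \<Rightarrow> 'i" where "n \<ge> 1" "inj_on \<alpha> {1..n}" "\<alpha> ` {1..n} = g ` {..<k}"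
    "\<forall>f :: 'i \<Rightarrow> real. (\<Prod>j<k. f (g j)) = (\<Prod>i=1..n. f (\<alpha> i) ^ card {j. j < k \<and> g j = \<alpha> i})"
proof -
  let ?V = "g ` {..<k}"
  obtain \<alpha> where \<alpha>: "bij_betw \<alpha> {1..card ?V} ?V" using ex_bij_betw_nat_finite_1[of ?V] by auto
  show ?thesis
  proof (rule that[of "card ?V" \<alpha>])
    show "card ?V \<ge> 1" using assms by (simp add: Suc_le_eq card_gt_0_iff lessThan_empty_iff)
    show "inj_on \<alpha> {1..card ?V}" "\<alpha> ` {1..card ?V} = ?V" using \<alpha> by (auto simp: bij_betw_def)
    show "\<forall>f :: 'i \<Rightarrow> real. (\<Prod>j<k. f (g j)) = (\<Prod>i=1..card ?V. f (\<alpha> i) ^ card {j. j < k \<and> g j = \<alpha> i})"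
    proof
      fix f :: "'i \<Rightarrow> real"
      have "(\<Prod>j<k. f (g j)) = (\<Prod>v\<in>?V. \<Prod>j | j \<in> {..<k} \<and> g j = v. f (g j))"
        by (rule prod.image_gen) simp
      also have "\<dots> = (\<Prod>v\<in>?V. f v ^ card {j. j < k \<and> g j = v})"
        by (intro prod.cong refl) simp
      also have "\<dots> = (\<Prod>i=1..card ?V. f (\<alpha> i) ^ card {j. j < k \<and> g j = \<alpha> i})"
        by (rule prod.reindex_bij_betw[OF \<alpha>, symmetric])
      finally show "(\<Prod>j<k. f (g j)) = (\<Prod>i=1..card ?V. f (\<alpha> i) ^ card {j. j < k \<and> g j = \<alpha> i})" .
    qed
  qed
qed

text \<open>A crude substitute for the Hoelder inequality: each factor is at most the largest, whose
  \<open>k\<close>-th power is among the summands. Constants depending on \<open>k\<close> do no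
  harm.\<close>

lemma abs_prod_le_sum_power:
  fixes a :: "nat \<Rightarrow> real"
  assumes "k \<ge> 1"
  shows "\<bar>\<Prod>j<k. a j\<bar> \<le> (\<Sum>j<k. \<bar>a j\<bar> ^ k)"
proof -
  let ?m = "Max ((\<lambda>j. \<bar>a j\<bar>) ` {..<k})"
  have ne: "(\<lambda>j. \<bar>a j\<bar>) ` {..<k} \<noteq> {}" using assms by (simp add: lessThan_empty_iff)
  then have "?m \<in> (\<lambda>j. \<bar>a j\<bar>) ` {..<k}" by (intro Max_in) auto
  then obtain j0 where j0: "j0 < k" "?m = \<bar>a j0\<bar>" by blast
  have "\<bar>\<Prod>j<k. a j\<bar> = (\<Prod>j<k. \<bar>a j\<bar>)" by (rule abs_prod)
  also have "\<dots> \<le> (\<Prod>j<k. ?m)" by (intro prod_mono) auto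
  also have "\<dots> = \<bar>a j0\<bar> ^ k" using j0 by simp
  also have "\<dots> \<le> (\<Sum>j<k. \<bar>a j\<bar> ^ k)" using j0(1) by (intro member_le_sum) auto
  finally show ?thesis .
qed

context prob_space
begin

lemma admissible_SMS_measurable:
  "admissible_SMS UNIV x \<Longrightarrow> x \<alpha> \<in> borel_measurable M"
  by (simp add: admissible_SMS_def SMS_def)

text \<open>The constant must not depend on \<open>g\<close>, as the indices along walks spread out
  with \<open>n\<close>. It is \<open>k\<close> times the supremum of the \<open>k\<close>-th
  absolute moments.\<close>

lemma uniformly_bounded_product_moments:
  fixes x :: "'i \<Rightarrow> 'a \<Rightarrow> real"
  assumes x: "\<And>\<alpha>. x \<alpha> \<in> borel_measurable M"
    and bounded: "uniformly_bounded_moments UNIV x" and k: "k \<ge> 1"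
  obtains C where "C \<ge> 0"
    "\<And>g :: nat \<Rightarrow> 'i. integrable M (\<lambda>\<omega>. \<Prod>j<k. x (g j) \<omega>)"
    "\<And>g :: nat \<Rightarrow> 'i. \<bar>expectation (\<lambda>\<omega>. \<Prod>j<k. x (g j) \<omega>)\<bar> \<le> C"
proof -
  define S where "S = (SUP \<alpha>. \<integral>\<^sup>+\<omega>. ennreal (\<bar>x \<alpha> \<omega>\<bar> powr real k) \<partial>M)"
  have S: "S < \<infinity>" using bounded k by (auto simp: uniformly_bounded_moments_def S_def)
  have le: "(\<integral>\<^sup>+\<omega>. ennreal (\<bar>x \<alpha> \<omega>\<bar> ^ k) \<partial>M) \<le> S" for \<alpha>
  proof -
    have "(\<integral>\<^sup>+\<omega>. ennreal (\<bar>x \<alpha> \<omega>\<bar> ^ k) \<partial>M) = (\<integral>\<^sup>+\<omega>. ennreal (\<bar>x \<alpha> \<omega>\<bar> powr real k) \<partial>M)"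
      using k by (intro nn_integral_cong) (simp add: powr_realpow')
    also have "\<dots> \<le> S" unfolding S_def by (rule SUP_upper) simp
    finally show ?thesis .
  qed
  have int: "integrable M (\<lambda>\<omega>. \<bar>x \<alpha> \<omega>\<bar> ^ k)" for \<alpha>
    using le[of \<alpha>] S x by (intro integrableI_bounded) (auto simp: le_less_trans)
  have E: "expectation (\<lambda>\<omega>. \<bar>x \<alpha> \<omega>\<bar> ^ k) \<le> enn2real S" for \<alpha>
  proof -
    have "ennreal (expectation (\<lambda>\<omega>. \<bar>x \<alpha> \<omega>\<bar> ^ k)) \<le> S"
      using le[of \<alpha>] nn_integral_eq_integral[OF int[of \<alpha>]] by simp
    then have "enn2real (ennreal (expectation (\<lambda>\<omega>. \<bar>x \<alpha> \<omega>\<bar> ^ k))) \<le> enn2real S"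
      using S by (intro enn2real_mono) auto
    then show ?thesis by simp
  qed
  have sum_int: "integrable M (\<lambda>\<omega>. \<Sum>j<k. \<bar>x (g j) \<omega>\<bar> ^ k)" for g :: "nat \<Rightarrow> 'i"
    using int by (intro Bochner_Integration.integrable_sum) auto
  have prod_int: "integrable M (\<lambda>\<omega>. \<Prod>j<k. x (g j) \<omega>)" for g :: "nat \<Rightarrow> 'i"
  proof (rule Bochner_Integration.integrable_bound[OF sum_int[of g]])
    show "(\<lambda>\<omega>. \<Prod>j<k. x (g j) \<omega>) \<in> borel_measurable M" using x by measurable
    show "AE \<omega> in M. norm (\<Prod>j<k. x (g j) \<omega>) \<le> norm (\<Sum>j<k. \<bar>x (g j) \<omega>\<bar> ^ k)"
    proof (intro AE_I2)
      fix \<omega>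
      have "0 \<le> (\<Sum>j<k. \<bar>x (g j) \<omega>\<bar> ^ k)" by (intro sum_nonneg) auto
      then show "norm (\<Prod>j<k. x (g j) \<omega>) \<le> norm (\<Sum>j<k. \<bar>x (g j) \<omega>\<bar> ^ k)"
        using abs_prod_le_sum_power[OF k, of "\<lambda>j. x (g j) \<omega>"] by simp
    qed
  qed
  have "\<bar>expectation (\<lambda>\<omega>. \<Prod>j<k. x (g j) \<omega>)\<bar> \<le> real k * enn2real S" for g :: "nat \<Rightarrow> 'i"
  proof -
    have "\<bar>expectation (\<lambda>\<omega>. \<Prod>j<k. x (g j) \<omega>)\<bar> \<le> expectation (\<lambda>\<omega>. \<bar>\<Prod>j<k. x (g j) \<omega>\<bar>)"
      by (rule integral_abs_bound)
    also have "\<dots> \<le> expectation (\<lambda>\<omega>. \<Sum>j<k. \<bar>x (g j) \<omega>\<bar> ^ k)"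
      by (intro integral_mono integrable_abs prod_int sum_int abs_prod_le_sum_power k)
    also have "\<dots> = (\<Sum>j<k. expectation (\<lambda>\<omega>. \<bar>x (g j) \<omega>\<bar> ^ k))"
      using int by (intro Bochner_Integration.integral_sum) auto
    also have "\<dots> \<le> (\<Sum>j<k. enn2real S)" by (intro sum_mono E)
    finally show ?thesis by simp
  qed
  then show ?thesis using prod_int by (intro that[of "real k * enn2real S"]) auto
qed

lemma admissible_SMS_product_eq_0:
  fixes g :: "nat \<Rightarrow> 'i"
  assumes "admissible_SMS UNIV x" "j < k" "\<And>l. l < k \<Longrightarrow> l \<noteq> j \<Longrightarrow> g l \<noteq> g j"
  shows "expectation (\<lambda>\<omega>. \<Prod>j<k. x (g j) \<omega>) = 0"
proof -
  have k: "k \<ge> 1" using assms(2) by simp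
  obtain n :: nat and \<alpha> where n: "n \<ge> 1" "inj_on \<alpha> {1..n}" "\<alpha> ` {1..n} = g ` {..<k}"
    and p: "\<forall>f :: 'i \<Rightarrow> real. (\<Prod>j<k. f (g j)) = (\<Prod>i=1..n. f (\<alpha> i) ^ card {j. j < k \<and> g j = \<alpha> i})"
    by (rule prod_by_values[OF k, of g])
  let ?\<eta> = "\<lambda>i. card {j. j < k \<and> g j = \<alpha> i}"
  have "?\<eta> i \<ge> 1" if "i \<in> {1..n}" for i
  proof -
    have "\<alpha> i \<in> g ` {..<k}" using n(3) that by blast
    then show ?thesis by (auto simp: Suc_le_eq card_gt_0_iff)
  qed
  moreover have "\<exists>i\<in>{1..n}. ?\<eta> i = 1"
  proof -
    have "g j \<in> \<alpha> ` {1..n}" using n(3) assms(2) by auto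
    then obtain i where i: "i \<in> {1..n}" "\<alpha> i = g j" by auto
    have "{l. l < k \<and> g l = \<alpha> i} = {j}" using assms(2,3) i(2) by auto
    then have "?\<eta> i = 1" by (simp only:) simp
    then show ?thesis using i(1) by blast
  qed
  ultimately have "expectation (\<lambda>\<omega>. \<Prod>i=1..n. x (\<alpha> i) \<omega> ^ ?\<eta> i) = 0"
    using n(2)
    by (intro assms(1)[unfolded admissible_SMS_def, THEN conjunct2, THEN conjunct2, THEN spec[of _ n],
          THEN mp, OF n(1), THEN spec[of _ \<alpha>], THEN spec[of _ ?\<eta>], THEN mp] conjI) auto
  then show ?thesis unfolding p[THEN spec, of "\<lambda>v. x v _"] .
qed

lemma SMS_product_eq_1:
  fixes g :: "nat \<Rightarrow> 'i"
  assumes "SMS UNIV x" "k \<ge> 1" "\<And>j. j < k \<Longrightarrow> card {l. l < k \<and> g l = g j} = 2"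
  shows "expectation (\<lambda>\<omega>. \<Prod>j<k. x (g j) \<omega>) = 1"
proof -
  obtain n :: nat and \<alpha> where n: "n \<ge> 1" "inj_on \<alpha> {1..n}" "\<alpha> ` {1..n} = g ` {..<k}"
    and p: "\<forall>f :: 'i \<Rightarrow> real. (\<Prod>j<k. f (g j)) = (\<Prod>i=1..n. f (\<alpha> i) ^ card {j. j < k \<and> g j = \<alpha> i})"
    by (rule prod_by_values[OF assms(2), of g])
  let ?\<eta> = "\<lambda>i. card {j. j < k \<and> g j = \<alpha> i}"
  have two: "?\<eta> i = 2" if "i \<in> {1..n}" for i
  proof -
    have "\<alpha> i \<in> g ` {..<k}" using n(3) that by blast
    then show ?thesis using assms(3) by auto
  qed
  have "expectation (\<lambda>\<omega>. \<Prod>i=1..n. x (\<alpha> i) \<omega> ^ ?\<eta> i) = (if \<forall>i\<in>{1..n}. ?\<eta> i = 2 then 1 else 0)"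
    using assms(1) n(1,2) two unfolding SMS_def
    by (elim conjE allE[of _ n] allE[of _ \<alpha>] allE[of _ ?\<eta>] impE) auto
  then show ?thesis unfolding p[THEN spec, of "\<lambda>v. x v _"] using two by simp
qed

lemma indep_families_product:
  fixes x :: "'i \<Rightarrow> 'a \<Rightarrow> real" and y :: "'i \<Rightarrow> 'a \<Rightarrow> real"
  assumes "indep_families UNIV x UNIV y"
    and "integrable M (\<lambda>\<omega>. \<Prod>j<k. x (a j) \<omega>)" "integrable M (\<lambda>\<omega>. \<Prod>j<k. y (b j) \<omega>)"
  shows "integrable M (\<lambda>\<omega>. \<Prod>j<k::nat. x (a j) \<omega> * y (b j) \<omega>)"
    and "expectation (\<lambda>\<omega>. \<Prod>j<k. x (a j) \<omega> * y (b j) \<omega>) =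
      expectation (\<lambda>\<omega>. \<Prod>j<k. x (a j) \<omega>) * expectation (\<lambda>\<omega>. \<Prod>j<k. y (b j) \<omega>)"
proof -
  have "indep_var borel ((\<lambda>h. \<Prod>j<k. h (a j)) \<circ> (\<lambda>\<omega>. \<lambda>\<alpha>\<in>UNIV. x \<alpha> \<omega>))
      borel ((\<lambda>h. \<Prod>j<k. h (b j)) \<circ> (\<lambda>\<omega>. \<lambda>\<beta>\<in>UNIV. y \<beta> \<omega>))"
    using assms(1) unfolding indep_families_def
    by (rule indep_var_compose) measurable
  then have ind: "indep_var borel (\<lambda>\<omega>. \<Prod>j<k. x (a j) \<omega>) borel (\<lambda>\<omega>. \<Prod>j<k. y (b j) \<omega>)"
    by (simp add: o_def)
  show "integrable M (\<lambda>\<omega>. \<Prod>j<k::nat. x (a j) \<omega> * y (b j) \<omega>)"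
    unfolding prod.distrib by (rule indep_var_integrable[OF ind assms(2,3)])
  show "expectation (\<lambda>\<omega>. \<Prod>j<k. x (a j) \<omega> * y (b j) \<omega>) =
      expectation (\<lambda>\<omega>. \<Prod>j<k. x (a j) \<omega>) * expectation (\<lambda>\<omega>. \<Prod>j<k. y (b j) \<omega>)"
    unfolding prod.distrib by (rule indep_var_lebesgue_integral[OF ind assms(2,3)])
qed

text \<open>The expectation after independence has split it. The 2 makes up for vertices starting at
  0; differences need no shift. Open walks get 0, so that sums may range over all of
  \<open>walks\<close>.\<close>

definition walk_moment :: "(int \<Rightarrow> 'a \<Rightarrow> real) \<Rightarrow> (int \<Rightarrow> 'a \<Rightarrow> real) \<Rightarrow>
    nat \<Rightarrow> (nat \<Rightarrow> letter) \<Rightarrow> (nat \<Rightarrow> nat) \<Rightarrow> real" where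
  "walk_moment x y k e i = (if i k = i 0
     then expectation (\<lambda>\<omega>. \<Prod>j<k. x (step_diff e i j) \<omega>) *
       expectation (\<lambda>\<omega>. \<Prod>j<k. y (step_sum i j + 2) \<omega>) else 0)"

text \<open>If the walk is open or some index occurs only once, both sides are 0, since a nonzero
  \<open>runs\<close> closes the walk and gives every step an opposite one with the same indices.
  Otherwise the pairing of a good walk makes every index occur exactly twice, and both sides are
  1.\<close>

lemma walk_moment_eq_runs:
  assumes x: "admissible_SMS UNIV x" and y: "admissible_SMS UNIV y" and k: "k \<ge> 1"
    and i: "i \<in> walks n k" "i \<notin> bad_walks n k e"
  shows "walk_moment x y k e i = real (runs e i k 0 [])"
proof (cases "i k = i 0 \<and>
    (\<forall>j<k. \<exists>l<k. l \<noteq> j \<and> step_diff e i l = step_diff e i j) \<and>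
    (\<forall>j<k. \<exists>l<k. l \<noteq> j \<and> step_sum i l = step_sum i j)")
  case False
  have "runs e i k 0 [] = 0"
  proof (rule ccontr)
    assume "runs e i k 0 [] \<noteq> 0"
    then have "i (0 + k) = i 0" and
      *: "\<forall>l. 0 \<le> l \<and> l < 0 + k \<longrightarrow> (\<exists>l'. l' \<noteq> l \<and> (0 \<le> l' \<and> l' < 0 + k \<or> l' \<in> set []) \<and> opposite_steps e i l l')"
      using runs_nonzero[of e i k 0 "[]"] by auto
    moreover have "\<exists>l<k. l \<noteq> j \<and> step_diff e i l = step_diff e i j \<and> step_sum i l = step_sum i j"
      if "j < k" for j
    proof -
      obtain l where "l \<noteq> j" "l < k" "opposite_steps e i j l" using * \<open>j < k\<close> by auto
      then show ?thesis using opposite_steps_eq[of e i j l] by blast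
    qed
    ultimately show False using False by (metis add_0)
  qed
  moreover have "walk_moment x y k e i = 0"
  proof (cases "i k = i 0")
    case True
    then consider j where "j < k" "\<And>l. l < k \<Longrightarrow> l \<noteq> j \<Longrightarrow> step_diff e i l \<noteq> step_diff e i j"
      | j where "j < k" "\<And>l. l < k \<Longrightarrow> l \<noteq> j \<Longrightarrow> step_sum i l \<noteq> step_sum i j"
      using False by blast
    then show ?thesis
    proof cases
      case 1
      then have "expectation (\<lambda>\<omega>. \<Prod>j<k. x (step_diff e i j) \<omega>) = 0"
        by (intro admissible_SMS_product_eq_0[OF x]) auto
      then show ?thesis by (simp add: walk_moment_def)
    next
      case 2
      then have "expectation (\<lambda>\<omega>. \<Prod>j<k. y (step_sum i j + 2) \<omega>) = 0"
        by (intro admissible_SMS_product_eq_0[OF y]) auto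
      then show ?thesis by (simp add: walk_moment_def)
    qed
  qed (simp add: walk_moment_def)
  ultimately show ?thesis by simp
next
  case True
  then have closed: "i k = i 0"
    and diffs: "\<And>j. j < k \<Longrightarrow> \<exists>l<k. l \<noteq> j \<and> step_diff e i l = step_diff e i j"
    and sums: "\<And>j. j < k \<Longrightarrow> \<exists>l<k. l \<noteq> j \<and> step_sum i l = step_sum i j"
    by blast+
  obtain f where f_all: "\<forall>j<k. f j < k" "\<forall>j<k. f j \<noteq> j" "\<forall>j<k. f (f j) = j"
    "\<forall>j<k. opposite_steps e i j (f j)"
    "\<forall>j<k. \<forall>l<k. l \<noteq> j \<longrightarrow> step_diff e i l = step_diff e i j \<longrightarrow> l = f j"
    "\<forall>j<k. \<forall>l<k. l \<noteq> j \<longrightarrow> step_sum i l = step_sum i j \<longrightarrow> l = f j"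
    "\<forall>j<k. \<forall>m. f j < m \<longrightarrow> m < j \<longrightarrow> f m < j"
    by (rule good_walk_pairing[OF i(1) closed i(2) diffs sums])
  note f = f_all[rule_format]
  have "runs e i k 0 [] = 1"
    by (rule runs_eq_1[OF f(1-4) _ f(7)]) (use f(5) opposite_steps_eq(1) in auto)
  moreover have "card {l. l < k \<and> step_diff e i l = step_diff e i j} = 2" if j: "j < k" for j
  proof -
    have "{l. l < k \<and> step_diff e i l = step_diff e i j} = {j, f j}"
      using f(5)[OF j] f(1)[OF j] opposite_steps_eq(1)[OF f(4)[OF j]] j by blast
    then show ?thesis using f(2)[OF j] by simp
  qed
  then have "expectation (\<lambda>\<omega>. \<Prod>j<k. x (step_diff e i j) \<omega>) = 1"
    using x k by (intro SMS_product_eq_1) (simp_all add: admissible_SMS_def)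
  moreover have "card {l. l < k \<and> step_sum i l + 2 = step_sum i j + 2} = 2" if j: "j < k" for j
  proof -
    have "{l. l < k \<and> step_sum i l + 2 = step_sum i j + 2} = {j, f j}"
      unfolding add_right_cancel
      using f(6)[OF j] f(1)[OF j] opposite_steps_eq(2)[OF f(4)[OF j]] j by blast
    then show ?thesis using f(2)[OF j] by simp
  qed
  then have "expectation (\<lambda>\<omega>. \<Prod>j<k. y (step_sum i j + 2) \<omega>) = 1"
    using y k by (intro SMS_product_eq_1) (simp_all add: admissible_SMS_def)
  ultimately show ?thesis using True by (simp add: walk_moment_def)
qed

end

section \<open>Passage to the limit\<close>

lemma sum_walks_runs:
  assumes "n > 0"
  shows "(\<Sum>i\<in>walks n k. real (runs e i k 0 [])) =
    real n * real (pairing_count (\<noteq>) (map e [0..<k]) []) * real n powr (real k / 2)"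
proof -
  have "(\<Sum>i\<in>walks n k. real (runs e i k 0 [])) =
      (\<Sum>v<n. \<Sum>i\<in>extensions n (Suc 0) k ((\<lambda>_. 0)(0 := v)). real (runs e i k 0 []))"
    by (rule sum_extensions_Suc)
  also have "\<dots> = (\<Sum>v<n. real (pairing_count (\<noteq>) (map e [0..<0+k]) (map e [])) *
      real n powr ((real k - real (length ([] :: nat list))) / 2))"
    using assms by (intro sum.cong refl sum_runs) auto
  finally show ?thesis by simp
qed

text \<open>Since \<open>sum_walks_runs\<close> is exact, the error is a sum over bad walks only.
  Their number, of order \<open>n ^ (1 + (k - 1) div 2)\<close>, is divided by
  \<open>n powr (1 + k/2)\<close>.\<close>

lemma walk_sum_limit:
  assumes runs: "\<And>n i. i \<in> walks n k \<Longrightarrow> i \<notin> bad_walks n k e \<Longrightarrow> F i = real (runs e i k 0 [])"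
    and C: "\<And>i. \<bar>F i\<bar> \<le> C" and k: "k \<ge> 1"
  shows "(\<lambda>n. 1 / real n * (1 / sqrt (real n)) ^ k * (\<Sum>i\<in>walks n k. F i))
    \<longlonglongrightarrow> real (pairing_count (\<noteq>) (map e [0..<k]) [])"
proof -
  let ?N = "real (pairing_count (\<noteq>) (map e [0..<k]) [])"
  \<comment> \<open>\<open>C\<close> bounds the summand and \<open>2 ^ k\<close> bounds
    \<open>runs\<close>, so \<open>D\<close> bounds the error made at one bad walk.\<close>
  define D where "D = C + 2 ^ k"
  have D: "D \<ge> 0" using C[of undefined] by (simp add: D_def)
  obtain K where K: "\<And>n. n > 0 \<Longrightarrow> card (bad_walks n k e) \<le> K * (n * (2 * n) ^ ((k - 1) div 2))"
    using card_bad_walks by blast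
  have bad_sub: "bad_walks n k e \<subseteq> walks n k" for n
    by (auto simp: bad_walks_def dependent_walks_def)
  have norm: "(1 / sqrt (real n)) ^ k = real n powr - (real k / 2)" if "n > 0" for n
  proof -
    have "1 / sqrt (real n) = real n powr - (1/2)"
      unfolding powr_minus by (simp only: powr_half_sqrt of_nat_0_le_iff inverse_eq_divide)
    then have "(1 / sqrt (real n)) ^ k = (real n powr - (1/2)) powr real k"
      using that by (simp only: powr_realpow powr_gt_zero of_nat_0_less_iff of_nat_eq_0_iff)
    also have "\<dots> = real n powr - (real k / 2)" by (simp add: powr_powr)
    finally show ?thesis .
  qed
  let ?R = "real K * D * 2 ^ ((k - 1) div 2)"
  have bound: "\<bar>1 / real n * (1 / sqrt (real n)) ^ k * (\<Sum>i\<in>walks n k. F i) - ?N\<bar>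
      \<le> ?R * real n powr - (1/2)" if n: "n > 0" for n
  proof -
    define c where "c = 1 / real n * real n powr - (real k / 2)"
    have c: "c \<ge> 0" by (simp add: c_def)
    have "?N = c * (\<Sum>i\<in>walks n k. real (runs e i k 0 []))"
      unfolding sum_walks_runs[OF n] using n by (simp add: c_def powr_minus field_simps)
    then have "\<bar>c * (\<Sum>i\<in>walks n k. F i) - ?N\<bar> =
        c * \<bar>\<Sum>i\<in>walks n k. F i - real (runs e i k 0 [])\<bar>"
      using c by (simp only: right_diff_distrib[symmetric] sum_subtractf abs_mult abs_of_nonneg)
    also have "(\<Sum>i\<in>walks n k. F i - real (runs e i k 0 [])) =
        (\<Sum>i\<in>bad_walks n k e. F i - real (runs e i k 0 []))"
      using bad_sub[of n] runs by (intro sum.mono_neutral_right) auto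
    also have "c * \<bar>\<dots>\<bar> \<le> c * (\<Sum>i\<in>bad_walks n k e. D)"
    proof (rule mult_left_mono[OF _ c])
      have "\<bar>F i - real (runs e i k 0 [])\<bar> \<le> D" for i
      proof -
        have "real (runs e i k 0 []) \<le> 2 ^ k"
          using runs_le[of e i k 0 "[]"] by (metis of_nat_le_iff of_nat_numeral of_nat_power)
        moreover have "0 \<le> real (runs e i k 0 [])" by simp
        ultimately show ?thesis using C[of i] unfolding D_def by linarith
      qed
      then show "\<bar>\<Sum>i\<in>bad_walks n k e. F i - real (runs e i k 0 [])\<bar> \<le> (\<Sum>i\<in>bad_walks n k e. D)"
        by (intro order_trans[OF sum_abs] sum_mono)
    qed
    also have "\<dots> = c * (real (card (bad_walks n k e)) * D)" by simp
    also have "\<dots> \<le> c * (real (K * (n * (2 * n) ^ ((k - 1) div 2))) * D)"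
      using K[OF n] D by (intro mult_left_mono[OF _ c] mult_right_mono) (simp_all only: of_nat_le_iff)
    also have "\<dots> = ?R * (real n ^ ((k - 1) div 2) * real n powr - (real k / 2))"
      using n by (simp add: c_def power_mult_distrib)
    also have "real n ^ ((k - 1) div 2) = real n powr real ((k - 1) div 2)"
      using n by (simp add: powr_realpow)
    also have "real n powr real ((k - 1) div 2) * real n powr - (real k / 2) =
        real n powr (real ((k - 1) div 2) - real k / 2)"
      by (simp add: powr_add[symmetric])
    also have "?R * \<dots> \<le> ?R * real n powr - (1/2)"
    proof (intro mult_left_mono powr_mono)
      have "2 * ((k - 1) div 2) + 1 \<le> k" using k by presburger
      then have "2 * real ((k - 1) div 2) + 1 \<le> real k" by linarith
      then show "real ((k - 1) div 2) - real k / 2 \<le> - (1/2)" by simp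
    qed (use n D in auto)
    finally show ?thesis unfolding norm[OF n] c_def .
  qed
  have "(\<lambda>n. ?R * real n powr - (1/2)) \<longlonglongrightarrow> ?R * 0"
    by (intro tendsto_mult tendsto_const tendsto_neg_powr filterlim_real_sequentially) simp
  then have lim: "(\<lambda>n. ?R * real n powr - (1/2)) \<longlonglongrightarrow> 0" by simp
  have "(\<lambda>n. 1 / real n * (1 / sqrt (real n)) ^ k * (\<Sum>i\<in>walks n k. F i) - ?N) \<longlonglongrightarrow> 0"
    by (rule Lim_null_comparison[OF _ lim])
      (use bound in \<open>auto simp: eventually_sequentially intro!: exI[of _ 1]\<close>)
  then show ?thesis by (simp only: LIM_zero_iff)
qed

section \<open>Traces of products\<close>

lemma mat_prod_list_carrier:
  "(\<And>A. A \<in> set As \<Longrightarrow> A \<in> carrier_mat n n) \<Longrightarrow> mat_prod_list n As \<in> carrier_mat n n"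
proof (induction As)
  case (Cons A As)
  then have "A * mat_prod_list n As \<in> carrier_mat n n"
    by (intro mult_carrier_mat[of _ n n]) auto
  then show ?case by (simp add: mat_prod_list_def)
qed (simp add: mat_prod_list_def)

text \<open>The window start \<open>j\<close> moves along as the induction strips the first matrix.
  The identity matrix closing the product yields the condition on the last vertex.\<close>

lemma mat_prod_list_entry:
  assumes "\<And>A. A \<in> set As \<Longrightarrow> A \<in> carrier_mat n n" "i j < n" "v < n"
  shows "mat_prod_list n As $$ (i j, v) = (\<Sum>i'\<in>extensions n (Suc j) (length As) i.
    if i' (j + length As) = v then \<Prod>l<length As. As ! l $$ (i' (j + l), i' (j + Suc l)) else 0)"
  using assms
proof (induction As arbitrary: i j)
  case Nil
  then show ?case by (auto simp: mat_prod_list_def)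
next
  case (Cons A As)
  let ?G = "\<lambda>i'. if i' (Suc j + length As) = v
    then \<Prod>l<length As. As ! l $$ (i' (Suc j + l), i' (Suc j + Suc l)) else 0"
  have B: "mat_prod_list n As \<in> carrier_mat n n" using Cons.prems(1) by (intro mat_prod_list_carrier) auto
  have A: "A \<in> carrier_mat n n" using Cons.prems(1) by simp
  have "mat_prod_list n (A # As) $$ (i j, v) = (A * mat_prod_list n As) $$ (i j, v)"
    by (simp add: mat_prod_list_def)
  also have "\<dots> = (\<Sum>z<n. A $$ (i j, z) * mat_prod_list n As $$ (z, v))"
    using A B Cons.prems(2,3) by (simp add: scalar_prod_def atLeast0LessThan)
  also have "\<dots> = (\<Sum>z<n. \<Sum>i'\<in>extensions n (Suc (Suc j)) (length As) (i(Suc j := z)). A $$ (i j, z) * ?G i')"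
  proof (intro sum.cong refl)
    fix z assume z: "z \<in> {..<n}"
    have "mat_prod_list n As $$ ((i(Suc j := z)) (Suc j), v) =
        (\<Sum>i'\<in>extensions n (Suc (Suc j)) (length As) (i(Suc j := z)). ?G i')"
      using Cons.prems z by (intro Cons.IH) auto
    then show "A $$ (i j, z) * mat_prod_list n As $$ (z, v) =
        (\<Sum>i'\<in>extensions n (Suc (Suc j)) (length As) (i(Suc j := z)). A $$ (i j, z) * ?G i')"
      by (simp add: sum_distrib_left)
  qed
  also have "\<dots> = (\<Sum>z<n. \<Sum>i'\<in>extensions n (Suc (Suc j)) (length As) (i(Suc j := z)).
     if i' (j + length (A # As)) = v
     then \<Prod>l<length (A # As). (A # As) ! l $$ (i' (j + l), i' (j + Suc l)) else 0)"
  proof (intro sum.cong refl)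
    fix z i' assume "i' \<in> extensions n (Suc (Suc j)) (length As) (i(Suc j := z))"
    then have "i' (Suc j) = z" "i' j = i j"
      using extensions_outside[of i' n "Suc (Suc j)" "length As" "i(Suc j := z)"] by auto
    then show "A $$ (i j, z) * ?G i' = (if i' (j + length (A # As)) = v
     then \<Prod>l<length (A # As). (A # As) ! l $$ (i' (j + l), i' (j + Suc l)) else 0)"
      by (simp add: prod.lessThan_Suc_shift del: prod.lessThan_Suc)
  qed
  also have "\<dots> = (\<Sum>i'\<in>extensions n (Suc j) (length (A # As)) i. if i' (j + length (A # As)) = v
     then \<Prod>l<length (A # As). (A # As) ! l $$ (i' (j + l), i' (j + Suc l)) else 0)"
    unfolding list.size(4) by (simp add: sum_extensions_Suc)
  finally show ?case .
qed

lemma mat_trace_prod_list: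
  assumes "\<And>A. A \<in> set As \<Longrightarrow> A \<in> carrier_mat n n"
  shows "mat_trace (mat_prod_list n As) = (\<Sum>i\<in>walks n (length As).
    if i (length As) = i 0 then \<Prod>l<length As. As ! l $$ (i l, i (Suc l)) else 0)"
proof -
  have "mat_prod_list n As \<in> carrier_mat n n" using assms by (rule mat_prod_list_carrier)
  then have "mat_trace (mat_prod_list n As) = (\<Sum>v<n. mat_prod_list n As $$ (v, v))"
    by (simp add: mat_trace_def)
  also have "\<dots> = (\<Sum>v<n. \<Sum>i\<in>extensions n (Suc 0) (length As) ((\<lambda>_. 0)(0 := v)).
      if i (length As) = i 0 then \<Prod>l<length As. As ! l $$ (i l, i (Suc l)) else 0)"
  proof (intro sum.cong refl)
    fix v assume v: "v \<in> {..<n}"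
    have "mat_prod_list n As $$ (((\<lambda>_. 0)(0 := v)) (0 :: nat), v) =
      (\<Sum>i\<in>extensions n (Suc 0) (length As) ((\<lambda>_. 0)(0 := v)).
      if i (0 + length As) = v then \<Prod>l<length As. As ! l $$ (i (0 + l), i (0 + Suc l)) else 0)"
      using v by (intro mat_prod_list_entry[of As n "(\<lambda>_. 0)(0 := v)" 0 v] assms) auto
    also have "\<dots> = (\<Sum>i\<in>extensions n (Suc 0) (length As) ((\<lambda>_. 0)(0 := v)).
      if i (length As) = i 0 then \<Prod>l<length As. As ! l $$ (i l, i (Suc l)) else 0)"
    proof (intro sum.cong refl)
      fix i assume "i \<in> extensions n (Suc 0) (length As) ((\<lambda>_. 0)(0 := v))"
      then have "i 0 = v" using extensions_outside[of i n "Suc 0" "length As" _ 0] by auto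
      then show "(if i (0 + length As) = v then \<Prod>l<length As. As ! l $$ (i (0 + l), i (0 + Suc l)) else 0) =
        (if i (length As) = i 0 then \<Prod>l<length As. As ! l $$ (i l, i (Suc l)) else 0)" by simp
    qed
    finally show "mat_prod_list n As $$ (v, v) =
      (\<Sum>i\<in>extensions n (Suc 0) (length As) ((\<lambda>_. 0)(0 := v)).
      if i (length As) = i 0 then \<Prod>l<length As. As ! l $$ (i l, i (Suc l)) else 0)" by simp
  qed
  also have "\<dots> = (\<Sum>i\<in>walks n (length As).
    if i (length As) = i 0 then \<Prod>l<length As. As ! l $$ (i l, i (Suc l)) else 0)"
    by (rule sum_extensions_Suc[symmetric])
  finally show ?thesis .
qed

lemma letter_matrix_carrier:
  "letter_apply mat_adjoint (complex_of_real r \<cdot>\<^sub>m M_mat x y n \<omega>) a \<in> carrier_mat n n"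
  by (cases a) (auto simp: M_mat_def mat_adjoint_def)

lemma letter_matrix_entry:
  assumes "u < n" "v < n"
  shows "letter_apply mat_adjoint (complex_of_real r \<cdot>\<^sub>m M_mat x y n \<omega>) a $$ (u, v) =
    complex_of_real (r * (x (letter_sign a * (int u - int v)) \<omega> * y (int u + int v + 2) \<omega>))"
  using assms by (cases a) (auto simp: M_mat_def mat_adjoint_def mat_of_rows_index algebra_simps)

theorem theorem3p2:
  fixes P :: "'w measure"
    and x y :: "int \<Rightarrow> 'w \<Rightarrow> real"
    and scale :: "complex \<Rightarrow> 'a::ring_1 \<Rightarrow> 'a"
    and star :: "'a \<Rightarrow> 'a"
    and \<phi> :: "'a \<Rightarrow> complex"
    and c :: 'a
    and \<epsilon> :: "letter list"
  assumes "prob_space P"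
    and "prob_space.admissible_SMS P UNIV x"
    and "prob_space.admissible_SMS P UNIV y"
    and "prob_space.uniformly_bounded_moments P UNIV x"
    and "prob_space.uniformly_bounded_moments P UNIV y"
    and "prob_space.indep_families P UNIV x UNIV y"
    and "star_prob_space scale star \<phi>"
    and "star_prob_space.circular scale star \<phi> c"
    and "\<epsilon> \<noteq> []"
  shows "(\<lambda>n. 1 / of_nat n *
           (\<integral>\<omega>. mat_trace (mat_prod_list n
               (map (letter_apply mat_adjoint
                       (complex_of_real (1 / sqrt (real n)) \<cdot>\<^sub>m M_mat x y n \<omega>)) \<epsilon>)) \<partial>P))
         \<longlonglongrightarrow> \<phi> (prod_list (map (letter_apply star c) \<epsilon>))"
proof -
  interpret P: prob_space P by fact
  interpret A: star_prob_space scale star \<phi> by fact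
  define k where "k = length \<epsilon>"
  have k: "k \<ge> 1" using assms(9) by (cases \<epsilon>) (auto simp: k_def)
  define e where "e j = \<epsilon> ! j" for j
  have map_e: "map e [0..<k] = \<epsilon>" by (simp add: k_def e_def[abs_def] map_nth)
  note meas = P.admissible_SMS_measurable
  obtain Cx where Cx: "Cx \<ge> 0" "\<And>g. integrable P (\<lambda>\<omega>. \<Prod>j<k. x (g j) \<omega>)"
    "\<And>g. \<bar>P.expectation (\<lambda>\<omega>. \<Prod>j<k. x (g j) \<omega>)\<bar> \<le> Cx"
    using P.uniformly_bounded_product_moments[OF meas[OF assms(2)] assms(4) k] by metis
  obtain Cy where Cy: "Cy \<ge> 0" "\<And>g. integrable P (\<lambda>\<omega>. \<Prod>j<k. y (g j) \<omega>)"
    "\<And>g. \<bar>P.expectation (\<lambda>\<omega>. \<Prod>j<k. y (g j) \<omega>)\<bar> \<le> Cy"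
    using P.uniformly_bounded_product_moments[OF meas[OF assms(3)] assms(5) k] by metis
  let ?F = "P.walk_moment x y k e"
  note ind = P.indep_families_product[OF assms(6) Cx(2) Cy(2)]
  have F_bound: "\<bar>?F i\<bar> \<le> Cx * Cy" for i
    using Cx Cy by (auto simp: P.walk_moment_def abs_mult intro!: mult_mono)
  \<comment> \<open>A general real \<open>r\<close> stands for the normalisation: the adjoint leaves
    it alone, and each of the \<open>k\<close> letters contributes it once.\<close>
  have E: "(\<integral>\<omega>. mat_trace (mat_prod_list n
      (map (letter_apply mat_adjoint (complex_of_real r \<cdot>\<^sub>m M_mat x y n \<omega>)) \<epsilon>)) \<partial>P) =
      complex_of_real (r ^ k * (\<Sum>i\<in>walks n k. ?F i))" for n r
  proof -
    let ?p = "\<lambda>i \<omega>. \<Prod>j<k. x (step_diff e i j) \<omega> * y (step_sum i j + 2) \<omega>"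
    have "mat_trace (mat_prod_list n
        (map (letter_apply mat_adjoint (complex_of_real r \<cdot>\<^sub>m M_mat x y n \<omega>)) \<epsilon>)) =
      (\<Sum>i\<in>walks n k. complex_of_real (r ^ k * (if i k = i 0 then ?p i \<omega> else 0)))" (is "?l = _") for \<omega>
    proof -
      let ?As = "map (letter_apply mat_adjoint (complex_of_real r \<cdot>\<^sub>m M_mat x y n \<omega>)) \<epsilon>"
      have "A \<in> carrier_mat n n" if "A \<in> set ?As" for A
        using that letter_matrix_carrier by auto
      from mat_trace_prod_list[of ?As, OF this]
      have "?l = (\<Sum>i\<in>walks n k. if i k = i 0 then \<Prod>l<k. ?As ! l $$ (i l, i (Suc l)) else 0)"
        by (simp only: length_map k_def)
      also have "\<dots> = (\<Sum>i\<in>walks n k. complex_of_real (r ^ k * (if i k = i 0 then ?p i \<omega> else 0)))"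
      proof (intro sum.cong refl)
        fix i assume i: "i \<in> walks n k"
        have "(\<Prod>l<k. ?As ! l $$ (i l, i (Suc l))) =
            (\<Prod>l<k. complex_of_real (r * (x (step_diff e i l) \<omega> * y (step_sum i l + 2) \<omega>)))"
        proof (intro prod.cong refl)
          fix l assume l: "l \<in> {..<k}"
          then have "i l < n" "i (Suc l) < n" using extensions_inside[OF i] by auto
          then show "?As ! l $$ (i l, i (Suc l)) =
            complex_of_real (r * (x (step_diff e i l) \<omega> * y (step_sum i l + 2) \<omega>))"
            using l letter_matrix_entry[of "i l" n "i (Suc l)" r x y \<omega> "\<epsilon> ! l"]
            by (simp add: k_def e_def step_diff_def step_sum_def)
        qed
        also have "\<dots> = complex_of_real (r ^ k * ?p i \<omega>)"
          by (simp only: of_real_prod[symmetric] prod.distrib prod_constant card_lessThan)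
        finally show "(if i k = i 0 then \<Prod>l<k. ?As ! l $$ (i l, i (Suc l)) else 0) =
            complex_of_real (r ^ k * (if i k = i 0 then ?p i \<omega> else 0))" by simp
      qed
      finally show ?thesis .
    qed
    then have "(\<integral>\<omega>. mat_trace (mat_prod_list n
        (map (letter_apply mat_adjoint (complex_of_real r \<cdot>\<^sub>m M_mat x y n \<omega>)) \<epsilon>)) \<partial>P) =
      (\<integral>\<omega>. complex_of_real (\<Sum>i\<in>walks n k. r ^ k * (if i k = i 0 then ?p i \<omega> else 0)) \<partial>P)"
      by simp
    also have "\<dots> = complex_of_real (\<integral>\<omega>. (\<Sum>i\<in>walks n k. r ^ k * (if i k = i 0 then ?p i \<omega> else 0)) \<partial>P)"
      by (rule integral_complex_of_real)
    also have "(\<integral>\<omega>. (\<Sum>i\<in>walks n k. r ^ k * (if i k = i 0 then ?p i \<omega> else 0)) \<partial>P) =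
        (\<Sum>i\<in>walks n k. \<integral>\<omega>. r ^ k * (if i k = i 0 then ?p i \<omega> else 0) \<partial>P)"
    proof (rule Bochner_Integration.integral_sum)
      fix i
      show "integrable P (\<lambda>\<omega>. r ^ k * (if i k = i 0 then ?p i \<omega> else 0))"
      proof (cases "i k = i 0")
        case True
        then show ?thesis by (simp only: if_True simp_thms) (intro integrable_mult_right ind(1))
      qed simp
    qed
    also have "\<dots> = (\<Sum>i\<in>walks n k. r ^ k * ?F i)"
    proof (intro sum.cong refl)
      fix i
      show "(\<integral>\<omega>. r ^ k * (if i k = i 0 then ?p i \<omega> else 0) \<partial>P) = r ^ k * ?F i"
      proof (cases "i k = i 0")
        case True
        then show ?thesis by (simp only: P.walk_moment_def if_True simp_thms integral_mult_right_zero ind(2))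
      qed (simp add: P.walk_moment_def)
    qed
    finally show ?thesis by (simp add: sum_distrib_left)
  qed
  have "(\<lambda>n. 1 / real n * (1 / sqrt (real n)) ^ k * (\<Sum>i\<in>walks n k. ?F i))
      \<longlonglongrightarrow> real (pairing_count (\<noteq>) (map e [0..<k]) [])"
    using P.walk_moment_eq_runs[OF assms(2,3) k] F_bound k by (rule walk_sum_limit)
  then have "(\<lambda>n. complex_of_real (1 / real n * (1 / sqrt (real n)) ^ k * (\<Sum>i\<in>walks n k. ?F i)))
      \<longlonglongrightarrow> complex_of_real (real (pairing_count (\<noteq>) \<epsilon> []))"
    unfolding map_e by (rule tendsto_of_real)
  then show ?thesis
    unfolding E A.circular_moment[OF assms(8)] by (simp add: mult.assoc)
qed

end
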